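(* Let $\Theta$ be a compact subset of a separable metric space with metric $d$, let $u\in\mathbb{N}$, and let $H:\Theta\times\mathbb{R}^u\to\mathbb{R}$ be a function such that (i) for each $x\in\mathbb{R}^u$, the map $\theta\mapsto H(\theta,x)$ is continuous on $\Theta$, and (ii) for each $\theta\in\Theta$, the map $x\mapsto H(\theta,x)$ is measurable on $\mathbb{R}^u$. Assume that there exist $a>0$, $M>0$, and $\delta>0$ such that for all $x\in\mathbb{R}^u$ and all $\theta,\theta'\in\Theta$, if $d(\theta,\theta')<\delta$ then $|H(\theta,x)-H(\theta',x)|\le M\,d(\theta,\theta')^a$. Assume also that there exist $c>0$ and $D>0$ such that $N(r)\le c\,r^{-D}$ for $r>0$, where $N(r)$ is the smallest number of open balls of radius $r$, centered at points in $\Theta$, needed to cover $\Theta$. Let $X_1,X_2,\ldots$ be i.i.d. random vectors in $\mathbb{R}^u$. For each $n\in\mathbb{N}$ let $W_{n1},\ldots,W_{nn}$ be real-valued negatively orthant dependent (NOD) random variables, where the random vectors $(W_{n1},\ldots,W_{nn})$, $n\in\mathbb{N}$, are independent across $n$ and are independent of the sequence $(X_1,X_2,\ldots)$. Let $p\in(1,2)$ and suppose that for some $$q>\frac{(1-1/p)D/a+1}{1/p-1/2}$$ we have $$\sup_{\theta\in\Theta}\mathbb{E}\big(|H(\theta,X_1)|^{q}\big)<\infty\quad\text{and}\quad \sum_{j=1}^n\mathbb{E}(|W_{nj}|^q)=O(n)\ \text{ as } n\to\infty.$$ Then $$\sup_{\theta\in\Theta}\bigg|\frac{1}{n^{1/p}}\sum_{j=1}^n\Big(W_{nj}H(\theta,X_j)-\mathbb{E}\big(W_{nj}H(\theta,X_j)\big)\Big)\bigg|\longrightarrow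 0\quad\text{almost surely as } n\to\infty.$$
   Context: A finite collection of real-valued random variables $Y_1,\ldots,Y_n$ is negatively orthant dependent (NOD) if for all $y_1,\ldots,y_n\in\mathbb{R}$ both $$\mathbb{P}(Y_1\le y_1,\ldots,Y_n\le y_n)\le\prod_{i=1}^n\mathbb{P}(Y_i\le y_i)\quad\text{and}\quad \mathbb{P}(Y_1>y_1,\ldots,Y_n>y_n)\le\prod_{i=1}^n\mathbb{P}(Y_i>y_i).$$ The open ball of radius $r$ centered at $\theta_0\in\Theta$ is $\{\theta\in\Theta: d(\theta,\theta_0)<r\}$. The constants $a$ and $D$ in the lower bound on $q$ are the exponents from the local Hölder condition and the covering-number condition, respectively. The weights $W_{nj}$ are not assumed to be identically distributed, exchangeable, or non-negative. All random variables are defined on a common probability space. *)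

theory Defs
  imports "HOL-Probability.Probability" "HOL-Library.Landau_Symbols"
begin

(* Only meaningful when some finite cover exists, e.g. for compact S and r > 0.
   For nonempty S the value is at least 1 for every r > 0, so a bound of the form
   c * r powr (- D) with D > 0 can only be required for r near 0; there it
   constrains S, and on any bounded range of r it then holds with a larger c. *)
definition covering_number :: "'a::metric_space set \<Rightarrow> real \<Rightarrow> nat" where
  "covering_number S r =
     (LEAST k. \<exists>C. C \<subseteq> S \<and> finite C \<and> card C = k \<and> S \<subseteq> (\<Union>x\<in>C. ball x r))"

definition neg_orthant_dependent :: "'b measure \<Rightarrow> 'i set \<Rightarrow> ('i \<Rightarrow> 'b \<Rightarrow> real) \<Rightarrow> bool" where
  "neg_orthant_dependent P I Y \<longleftrightarrow>
     finite I \<and> (\<forall>i\<in>I. Y i \<in> borel_measurable P) \<and>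
     (\<forall>y :: 'i \<Rightarrow> real.
        measure P {\<omega> \<in> space P. \<forall>i\<in>I. Y i \<omega> \<le> y i}
          \<le> (\<Prod>i\<in>I. measure P {\<omega> \<in> space P. Y i \<omega> \<le> y i}) \<and>
        measure P {\<omega> \<in> space P. \<forall>i\<in>I. Y i \<omega> > y i}
          \<le> (\<Prod>i\<in>I. measure P {\<omega> \<in> space P. Y i \<omega> > y i}))"

(* Independence of two random elements whose value types may differ, which the
   library's prob_space.indep_var does not allow: the generated sigma-algebras are
   independent. *)
definition indep_pair ::
  "'b measure \<Rightarrow> 's measure \<Rightarrow> ('b \<Rightarrow> 's) \<Rightarrow> 't measure \<Rightarrow> ('b \<Rightarrow> 't) \<Rightarrow> bool" where
  "indep_pair P S U T V \<longleftrightarrow>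
     U \<in> measurable P S \<and> V \<in> measurable P T \<and>
     prob_space.indep_set P
       {U -` A \<inter> space P | A. A \<in> sets S} {V -` B \<inter> space P | B. B \<in> sets T}"

end

theory Submission
  imports Defs
begin

text \<open>Fix a parameter and write $S_n(\theta)$ for the centred sum in the theorem. The heart of the matter is a
tail bound with the strength of the independent case,
$$P(|S_n(\theta)| > 2x) = O(n^{q/2} x^{-q}),$$
uniformly in $\theta$ (\<open>NOD_weighted_sum_moment_tail\<close>). Given this bound, \<open>\<Theta>\<close> is covered by $O(n^{\gamma D})$ balls of
radius $n^{-\gamma}$, with $\gamma$ slightly larger than $(1 - 1/p)/a$. Inside a ball the Hoelder condition
lets $S_n$ vary by at most a constant times $n^{-\gamma a} \sum_j (|W_{nj}| + E|W_{nj}|)$. The sum is almost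
surely $O(n)$ (\<open>NOD_abs_sum_moment_tail\<close> with $x = n$ and the Borel-Cantelli lemma, which applies since
$q > 2$), so the variation is $o(n^{1/p})$. On the centres, take $x = n^\beta$ with $\beta$ slightly smaller than
$1/p$: the probability that some centre has a deviation larger than $2x$ is
$O(n^{\gamma D + q/2 - q\beta})$. The hypothesis on \<open>q\<close> says precisely that
$(1 - 1/p)D/a + q/2 - q/p < -1$, so that for $\gamma$ and $\beta$ close to their limits these
probabilities are summable, and Borel-Cantelli finishes the proof.

The tail bound rests on two closure properties of upper orthant dependence. Increasing continuous maps preserve
it (\<open>upper_orthant_dependent_mono\<close>), and so does multiplication by independent nonnegative
factors that are independent of the family (\<open>upper_orthant_dependent_mult_indep\<close>); the latter covers the
products $W_{nj} h(X_j)$ with $h$ the positive or negative part of $H(\theta, \cdot)$. Negating the weights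
swaps the two orthant inequalities and hence both one-sided tails are reached. For nonnegative upper orthant dependent
variables the mean of the product is at most the product of the means
(\<open>upper_orthant_dependent_nn_integral_prod_le\<close>), which is all that Chernoff's method needs: one
obtains a Fuk-Nagaev inequality (\<open>upper_orthant_dependent_fuk_nagaev\<close>), and truncation at a fixed multiple of
\<open>x\<close> yields the polynomial tail (\<open>upper_orthant_dependent_moment_tail\<close>).\<close>

section \<open>Upper orthant dependence\<close>

text \<open>One half of negative orthant dependence, the half that exponential moments see. Negating the variables turns the
lower orthant inequality into this one, so a single notion serves both tails. The bound is
demanded for every subfamily because preimages of orthants under increasing maps may leave some
coordinates unconstrained.\<close>
definition (in prob_space) upper_orthant_dependent :: "'i set \<Rightarrow> ('i \<Rightarrow> 'a \<Rightarrow> real) \<Rightarrow> bool" where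
  "upper_orthant_dependent I Y \<longleftrightarrow>
     finite I \<and> (\<forall>i\<in>I. Y i \<in> borel_measurable M) \<and>
     (\<forall>J y. J \<subseteq> I \<longrightarrow>
        prob {\<omega> \<in> space M. \<forall>i\<in>J. y i < Y i \<omega>} \<le> (\<Prod>i\<in>J. prob {\<omega> \<in> space M. y i < Y i \<omega>}))"

lemma (in prob_space) prob_Ball_subset:
  assumes "J \<subseteq> I" "\<And>i. i \<in> I - J \<Longrightarrow> F i = space M" "\<And>i. i \<in> J \<Longrightarrow> F i = {\<omega> \<in> space M. Q i \<omega>}"
  shows "{\<omega> \<in> space M. \<forall>i\<in>I. \<omega> \<in> F i} = {\<omega> \<in> space M. \<forall>i\<in>J. Q i \<omega>}"
    and "finite I \<Longrightarrow> (\<Prod>i\<in>I. prob (F i)) = (\<Prod>i\<in>J. prob {\<omega> \<in> space M. Q i \<omega>})"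
proof -
  show "{\<omega> \<in> space M. \<forall>i\<in>I. \<omega> \<in> F i} = {\<omega> \<in> space M. \<forall>i\<in>J. Q i \<omega>}"
    using assms by blast
  assume "finite I"
  then have "(\<Prod>i\<in>I. prob (F i)) = (\<Prod>i\<in>J. prob (F i))"
    by (rule prod.mono_neutral_right) (use assms prob_space in auto)
  then show "(\<Prod>i\<in>I. prob (F i)) = (\<Prod>i\<in>J. prob {\<omega> \<in> space M. Q i \<omega>})"
    using assms(3) by simp
qed

text \<open>Continuity from below turns product bounds for approximating events into a product bound for the limit
events; coordinates whose events exhaust the space disappear from both sides. This is how a bound for
all coordinates passes to a subfamily, and how weak inequalities pass to strict ones.\<close>
lemma (in prob_space) prob_Ball_le_prod_limit:
  fixes R :: "'i \<Rightarrow> nat \<Rightarrow> 'a \<Rightarrow> bool"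
  assumes "finite I" "J \<subseteq> I"
    and meas: "\<And>i k. i \<in> I \<Longrightarrow> {\<omega> \<in> space M. R i k \<omega>} \<in> events"
    and inc: "\<And>i k l \<omega>. i \<in> I \<Longrightarrow> k \<le> l \<Longrightarrow> R i k \<omega> \<Longrightarrow> R i l \<omega>"
    and le: "\<And>k. prob {\<omega> \<in> space M. \<forall>i\<in>I. R i k \<omega>} \<le> (\<Prod>i\<in>I. prob {\<omega> \<in> space M. R i k \<omega>})"
    and Q: "\<And>i \<omega>. i \<in> J \<Longrightarrow> (\<exists>k. R i k \<omega>) \<longleftrightarrow> Q i \<omega>"
    and R_out: "\<And>i \<omega>. i \<in> I - J \<Longrightarrow> \<exists>k. R i k \<omega>"
  shows "prob {\<omega> \<in> space M. \<forall>i\<in>J. Q i \<omega>} \<le> (\<Prod>i\<in>J. prob {\<omega> \<in> space M. Q i \<omega>})"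
proof -
  define E where "E i k = {\<omega> \<in> space M. R i k \<omega>}" for i k
  define A where "A k = {\<omega> \<in> space M. \<forall>i\<in>I. R i k \<omega>}" for k
  have E_meas: "E i k \<in> events" if "i \<in> I" for i k
    using meas[OF that] by (simp add: E_def)
  have A_meas: "A k \<in> events" for k
    unfolding A_def using meas \<open>finite I\<close> by (intro sets.sets_Collect_finite_All) auto
  have A_inc: "incseq A"
    unfolding incseq_def A_def using inc by blast
  have *: "\<exists>k. \<omega> \<in> A k" if \<omega>: "\<omega> \<in> space M" "\<forall>i\<in>J. Q i \<omega>" for \<omega>
  proof -
    have "\<exists>k. R i k \<omega>" if "i \<in> I" for i
      using that \<omega>(2) Q[of i] R_out[of i] by (cases "i \<in> J") auto
    then obtain k where k: "\<forall>i\<in>I. R i (k i) \<omega>" by metis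
    \<comment> \<open>The sum serves as a common upper bound of finitely many indices.\<close>
    have "k i \<le> (\<Sum>i\<in>I. k i)" if "i \<in> I" for i
      using \<open>finite I\<close> that by (simp add: member_le_sum)
    then show ?thesis unfolding A_def using k \<omega>(1) inc by blast
  qed
  have UN: "{\<omega> \<in> space M. \<forall>i\<in>J. Q i \<omega>} = (\<Union>k. A k)"
  proof (intro set_eqI iffI)
    fix \<omega> assume "\<omega> \<in> (\<Union>k. A k)"
    then obtain k where "\<omega> \<in> space M" "\<forall>i\<in>I. R i k \<omega>" by (auto simp: A_def)
    then show "\<omega> \<in> {\<omega> \<in> space M. \<forall>i\<in>J. Q i \<omega>}"
      using Q[symmetric] \<open>J \<subseteq> I\<close> by auto
  qed (use * in simp)
  have prod_eq: "(\<Prod>i\<in>I. prob (\<Union>k. E i k)) = (\<Prod>i\<in>J. prob {\<omega> \<in> space M. Q i \<omega>})"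
  proof (rule prod.mono_neutral_cong_right)
    show "prob (\<Union>k. E i k) = prob {\<omega> \<in> space M. Q i \<omega>}" if "i \<in> J" for i
    proof -
      have "(\<Union>k. E i k) = {\<omega> \<in> space M. Q i \<omega>}" using Q[OF that] by (auto simp: E_def)
      then show ?thesis by simp
    qed
    have "(\<Union>k. E i k) = space M" if "i \<in> I - J" for i 
      using R_out[OF that] by (auto simp: E_def)
    then show "\<forall>i\<in>I - J. prob (\<Union>k. E i k) = 1" by (simp add: prob_space)
  qed fact+
  have "(\<lambda>k. prob (A k)) \<longlonglongrightarrow> prob (\<Union>k. A k)"
    by (rule finite_Lim_measure_incseq) (use A_meas A_inc in auto)
  moreover have "prob (A k) \<le> (\<Prod>i\<in>I. prob (\<Union>k. E i k))" for k
  proof -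
    have "prob (A k) \<le> (\<Prod>i\<in>I. prob (E i k))" using le unfolding A_def E_def .
    also have "\<dots> \<le> (\<Prod>i\<in>I. prob (\<Union>k. E i k))"
      by (intro prod_mono conjI finite_measure_mono sets.countable_UN measure_nonneg)
        (use E_meas in auto)
    finally show ?thesis .
  qed
  ultimately have "prob (\<Union>k. A k) \<le> (\<Prod>i\<in>I. prob (\<Union>k. E i k))"
    by (intro LIMSEQ_le_const2) blast+
  then show ?thesis
    unfolding UN prod_eq .
qed

text \<open>Thresholds tending to $-\infty$ release the coordinates outside the subfamily.\<close>
lemma (in prob_space) upper_orthant_dependent_of_NOD:
  assumes "neg_orthant_dependent M I Y"
  shows "upper_orthant_dependent I Y"
  unfolding upper_orthant_dependent_def
proof (intro conjI allI impI)
  show fin: "finite I" and meas: "\<forall>i\<in>I. Y i \<in> borel_measurable M"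
    using assms unfolding neg_orthant_dependent_def by blast+
  fix J :: "'b set" and y assume "J \<subseteq> I"
  define t where "t i k = (if i \<in> J then y i else - real k)" for i k
  show "prob {\<omega> \<in> space M. \<forall>i\<in>J. y i < Y i \<omega>} \<le> (\<Prod>i\<in>J. prob {\<omega> \<in> space M. y i < Y i \<omega>})"
  proof (rule prob_Ball_le_prod_limit[OF fin \<open>J \<subseteq> I\<close>, where R = "\<lambda>i k \<omega>. t i k < Y i \<omega>"])
    fix k
    show "prob {\<omega> \<in> space M. \<forall>i\<in>I. t i k < Y i \<omega>} \<le> (\<Prod>i\<in>I. prob {\<omega> \<in> space M. t i k < Y i \<omega>})"
      using assms[unfolded neg_orthant_dependent_def, THEN conjunct2, THEN conjunct2, rule_format, of "\<lambda>i. t i k"] by (rule conjunct2)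
    show "{\<omega> \<in> space M. t i k < Y i \<omega>} \<in> events" if "i \<in> I" for i
      using meas[rule_format, OF that] by measurable
    show "t i l < Y i \<omega>" if "k \<le> l" "t i k < Y i \<omega>" for i l \<omega>
      using that by (auto simp: t_def split: if_splits)
    show "(\<exists>k. t i k < Y i \<omega>) \<longleftrightarrow> y i < Y i \<omega>" if "i \<in> J" for i \<omega>
      using that by (simp add: t_def)
    show "\<exists>k. t i k < Y i \<omega>" if "i \<in> I - J" for i \<omega>
      using that reals_Archimedean2[of "- Y i \<omega>"] by (simp add: t_def minus_less_iff)
  qed
qed

text \<open>Negation exchanges the two orthant inequalities. The lower one concerns \<open>Y i \<le> y i\<close>, while the strict
inequality \<open>y i < - Y i\<close> is needed, so the thresholds also approach their limits from below.\<close>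
lemma (in prob_space) upper_orthant_dependent_uminus_of_NOD:
  assumes "neg_orthant_dependent M I Y"
  shows "upper_orthant_dependent I (\<lambda>i \<omega>. - Y i \<omega>)"
  unfolding upper_orthant_dependent_def
proof (intro conjI allI impI)
  have meas: "\<forall>i\<in>I. Y i \<in> borel_measurable M"
    using assms unfolding neg_orthant_dependent_def by blast
  then show "\<forall>i\<in>I. (\<lambda>\<omega>. - Y i \<omega>) \<in> borel_measurable M"
    by simp
  show fin: "finite I"
    using assms unfolding neg_orthant_dependent_def by blast
  fix J :: "'b set" and y assume "J \<subseteq> I"
  define t where "t i k = (if i \<in> J then - y i - 1 / real (Suc k) else real k)" for i k
  show "prob {\<omega> \<in> space M. \<forall>i\<in>J. y i < - Y i \<omega>} \<le> (\<Prod>i\<in>J. prob {\<omega> \<in> space M. y i < - Y i \<omega>})"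
  proof (rule prob_Ball_le_prod_limit[OF fin \<open>J \<subseteq> I\<close>, where R = "\<lambda>i k \<omega>. Y i \<omega> \<le> t i k"])
    fix k
    show "prob {\<omega> \<in> space M. \<forall>i\<in>I. Y i \<omega> \<le> t i k} \<le> (\<Prod>i\<in>I. prob {\<omega> \<in> space M. Y i \<omega> \<le> t i k})"
      using assms[unfolded neg_orthant_dependent_def, THEN conjunct2, THEN conjunct2, rule_format, of "\<lambda>i. t i k"] by (rule conjunct1)
    show "{\<omega> \<in> space M. Y i \<omega> \<le> t i k} \<in> events" if "i \<in> I" for i
      using meas[rule_format, OF that] by measurable
    show "Y i \<omega> \<le> t i l" if "k \<le> l" "Y i \<omega> \<le> t i k" for i l \<omega>
    proof -
      have "1 / real (Suc l) \<le> 1 / real (Suc k)" using that(1) by (simp add: frac_le)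
      then have "t i k \<le> t i l" using that(1) by (simp add: t_def)
      then show ?thesis using that(2) by simp
    qed
    show "(\<exists>k. Y i \<omega> \<le> t i k) \<longleftrightarrow> y i < - Y i \<omega>" if "i \<in> J" for i \<omega>
    proof
      assume "\<exists>k. Y i \<omega> \<le> t i k"
      then obtain k where "Y i \<omega> \<le> - y i - 1 / real (Suc k)"
        using \<open>i \<in> J\<close> unfolding t_def by auto
      moreover have "0 < 1 / real (Suc k)" by simp
      ultimately show "y i < - Y i \<omega>" by linarith
    next
      assume "y i < - Y i \<omega>"
      then have "0 < - y i - Y i \<omega>" by simp
      then obtain k where "1 / real (Suc k) < - y i - Y i \<omega>" using nat_approx_posE by blast
      then have "Y i \<omega> \<le> t i k" using that unfolding t_def by simp
      then show "\<exists>k. Y i \<omega> \<le> t i k" ..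
    qed
    show "\<exists>k. Y i \<omega> \<le> t i k" if "i \<in> I - J" for i \<omega>
      using that by (simp add: t_def real_arch_simple)
  qed
qed

lemma open_upclosed_real:
  fixes S :: "real set"
  assumes "open S" "\<And>x y. x \<in> S \<Longrightarrow> x \<le> y \<Longrightarrow> y \<in> S" "S \<noteq> {}" "S \<noteq> UNIV"
  shows "S = {Inf S<..}"
proof -
  obtain b where "b \<notin> S" using assms(4) by blast
  then have bdd: "bdd_below S" using assms(2) by (meson bdd_belowI linear)
  have "x \<in> S" if "Inf S < x" for x
    using that assms(2,3) cInf_lessD by (metis less_imp_le)
  moreover have "Inf S < x" if "x \<in> S" for x
  proof -
    obtain e where e: "e > 0" "ball x e \<subseteq> S" using assms(1) \<open>x \<in> S\<close> openE by blast
    have "x - e / 2 \<in> S" using e by (auto simp: subset_iff dist_real_def)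
    then have "Inf S \<le> x - e / 2" by (rule cInf_lower[OF _ bdd])
    then show ?thesis using e(1) by simp
  qed
  ultimately show ?thesis by auto
qed

text \<open>For a continuous increasing map, a set where the map exceeds a level is an open ray, empty or the whole
line. An empty one makes the joint probability zero, whole lines drop out, and the rays give an orthant event
of the original family.\<close>
lemma (in prob_space) upper_orthant_dependent_mono:
  fixes f :: "'i \<Rightarrow> real \<Rightarrow> real"
  assumes UO: "upper_orthant_dependent I Y"
    and cont: "\<And>i. i \<in> I \<Longrightarrow> continuous_on UNIV (f i)"
    and mono: "\<And>i. i \<in> I \<Longrightarrow> mono (f i)"
  shows "upper_orthant_dependent I (\<lambda>i \<omega>. f i (Y i \<omega>))"
  unfolding upper_orthant_dependent_def
proof (intro conjI allI impI)
  show fin: "finite I" and "\<forall>i\<in>I. (\<lambda>\<omega>. f i (Y i \<omega>)) \<in> borel_measurable M"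
    using UO cont by (auto simp: upper_orthant_dependent_def 
        intro: measurable_compose[OF _ borel_measurable_continuous_onI])
  fix J s assume J: "J \<subseteq> I"
  define S where "S i = {z. s i < f i z}" for i
  have S_eq: "S i = {Inf (S i)<..}" if "i \<in> J" "S i \<noteq> {}" "S i \<noteq> UNIV" for i
  proof (rule open_upclosed_real)
    show "open (S i)" unfolding S_def
      using cont[of i] that J by (intro open_Collect_less continuous_intros) auto
    show "y \<in> S i" if "x \<in> S i" "x \<le> y" for x y
      using that monoD[OF mono, of i x y] \<open>i \<in> J\<close> J unfolding S_def by fastforce
  qed fact+
  show "prob {\<omega> \<in> space M. \<forall>i\<in>J. s i < f i (Y i \<omega>)} \<le> (\<Prod>i\<in>J. prob {\<omega> \<in> space M. s i < f i (Y i \<omega>)})"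
  proof (cases "\<exists>i\<in>J. S i = {}")
    case True
    then have "{\<omega> \<in> space M. \<forall>i\<in>J. s i < f i (Y i \<omega>)} = {}"
      unfolding S_def by blast
    then have "prob {\<omega> \<in> space M. \<forall>i\<in>J. s i < f i (Y i \<omega>)} = 0"
      by (simp only: measure_empty)
    then show ?thesis by (simp add: prod_nonneg)
  next
    case False
    define J' where "J' = {i\<in>J. S i \<noteq> UNIV}"
    have *: "{\<omega> \<in> space M. s i < f i (Y i \<omega>)} = {\<omega> \<in> space M. Inf (S i) < Y i \<omega>}" if "i \<in> J'" for i
      using S_eq[of i] that False unfolding J'_def S_def by blast
    have **: "{\<omega> \<in> space M. s i < f i (Y i \<omega>)} = space M" if "i \<in> J - J'" for i
      using that unfolding J'_def S_def by blast
    have sub: "J' \<subseteq> J" by (auto simp: J'_def)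
    have finJ: "finite J" using J fin finite_subset by blast
    note eqs = prob_Ball_subset[of J' J "\<lambda>i. {\<omega> \<in> space M. s i < f i (Y i \<omega>)}" 
        "\<lambda>i \<omega>. Inf (S i) < Y i \<omega>", OF sub ** *]
    have "prob {\<omega> \<in> space M. \<forall>i\<in>J'. Inf (S i) < Y i \<omega>} \<le> (\<Prod>i\<in>J'. prob {\<omega> \<in> space M. Inf (S i) < Y i \<omega>})"
      using UO sub J unfolding upper_orthant_dependent_def by (meson subset_trans)
    moreover have "{\<omega> \<in> space M. \<forall>i\<in>J. \<omega> \<in> {\<omega> \<in> space M. s i < f i (Y i \<omega>)}} = {\<omega> \<in> space M. \<forall>i\<in>J. s i < f i (Y i \<omega>)}"
      by blast
    ultimately show ?thesis
      using eqs finJ by simp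
  qed
qed

section \<open>Independent multipliers\<close>

text \<open>Tonelli's theorem: the joint law is the product of the two laws.\<close>
lemma (in prob_space) indep_pair_nn_integral:
  assumes indep: "indep_pair M S U T V" and f: "f \<in> borel_measurable (S \<Otimes>\<^sub>M T)"
  shows "(\<integral>\<^sup>+\<omega>. f (U \<omega>, V \<omega>) \<partial>M) = (\<integral>\<^sup>+\<omega>'. \<integral>\<^sup>+\<omega>. f (U \<omega>, V \<omega>') \<partial>M \<partial>M)"
proof -
  have U [measurable]: "U \<in> measurable M S" and V [measurable]: "V \<in> measurable M T"
    and ind: "indep_set {U -` A \<inter> space M | A. A \<in> sets S} {V -` B \<inter> space M | B. B \<in> sets T}"
    using indep by (auto simp: indep_pair_def)
  note f [measurable]
  interpret U: prob_space "distr M S U" by (rule prob_space_distr) fact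
  interpret V: prob_space "distr M T V" by (rule prob_space_distr) fact
  interpret UV: pair_sigma_finite "distr M S U" "distr M T V" ..
  have joint: "distr M S U \<Otimes>\<^sub>M distr M T V = distr M (S \<Otimes>\<^sub>M T) (\<lambda>\<omega>. (U \<omega>, V \<omega>))"
  proof (rule pair_measure_eqI)
    fix A B assume A: "A \<in> sets (distr M S U)" and B: "B \<in> sets (distr M T V)"
    have "prob ((U -` A \<inter> space M) \<inter> (V -` B \<inter> space M)) = prob (U -` A \<inter> space M) * prob (V -` B \<inter> space M)"
      using A B by (intro indep_setD[OF ind]) auto
    moreover have "(\<lambda>\<omega>. (U \<omega>, V \<omega>)) -` (A \<times> B) \<inter> space M = (U -` A \<inter> space M) \<inter> (V -` B \<inter> space M)"
      by auto
    ultimately show "emeasure (distr M S U) A * emeasure (distr M T V) B =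
        emeasure (distr M (S \<Otimes>\<^sub>M T) (\<lambda>\<omega>. (U \<omega>, V \<omega>))) (A \<times> B)"
      using A B by (simp add: emeasure_distr emeasure_eq_measure ennreal_mult'')
  qed (auto intro: U.sigma_finite_measure_axioms V.sigma_finite_measure_axioms)
  have "(\<integral>\<^sup>+\<omega>. f (U \<omega>, V \<omega>) \<partial>M) = (\<integral>\<^sup>+z. f z \<partial>distr M (S \<Otimes>\<^sub>M T) (\<lambda>\<omega>. (U \<omega>, V \<omega>)))"
    by (subst nn_integral_distr) auto
  also have "\<dots> = (\<integral>\<^sup>+v. \<integral>\<^sup>+u. f (u, v) \<partial>distr M S U \<partial>distr M T V)"
    unfolding joint[symmetric] by (subst UV.nn_integral_snd) auto
  also have "\<dots> = (\<integral>\<^sup>+\<omega>'. (\<integral>\<^sup>+u. f (u, V \<omega>') \<partial>distr M S U) \<partial>M)"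
    by (subst nn_integral_distr) (auto intro!: U.borel_measurable_nn_integral)
  also have "\<dots> = (\<integral>\<^sup>+\<omega>'. \<integral>\<^sup>+\<omega>. f (U \<omega>, V \<omega>') \<partial>M \<partial>M)"
    by (intro nn_integral_cong, subst nn_integral_distr) (auto dest: measurable_space[OF V])
  finally show ?thesis .
qed

lemma (in prob_space) indep_pair_compose:
  assumes indep: "indep_pair M S U T V"
    and f: "f \<in> measurable S S'" and g: "g \<in> measurable T T'"
  shows "indep_pair M S' (\<lambda>\<omega>. f (U \<omega>)) T' (\<lambda>\<omega>. g (V \<omega>))"
proof -
  have U: "U \<in> measurable M S" and V: "V \<in> measurable M T"
    and ind: "indep_set {U -` A \<inter> space M | A. A \<in> sets S} {V -` B \<inter> space M | B. B \<in> sets T}"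
    using indep by (auto simp: indep_pair_def)
  have pull: "\<exists>A'. (\<lambda>\<omega>. h (Z \<omega>)) -` A \<inter> space M = Z -` A' \<inter> space M \<and> A' \<in> sets N"
    if "h \<in> measurable N N'" "Z \<in> measurable M N" "A \<in> sets N'" for h N N' Z and A
    using that measurable_space[OF that(2)] by (intro exI[of _ "h -` A \<inter> space N"]) auto
  have "indep_set {(\<lambda>\<omega>. f (U \<omega>)) -` A \<inter> space M | A. A \<in> sets S'}
      {(\<lambda>\<omega>. g (V \<omega>)) -` B \<inter> space M | B. B \<in> sets T'}"
    using ind unfolding indep_set_def
  proof (rule indep_sets_mono_sets)
    fix b show "case_bool {(\<lambda>\<omega>. f (U \<omega>)) -` A \<inter> space M |A. A \<in> sets S'} {(\<lambda>\<omega>. g (V \<omega>)) -` B \<inter> space M |B. B \<in> sets T'} b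
      \<subseteq> case_bool {U -` A \<inter> space M |A. A \<in> sets S} {V -` B \<inter> space M |B. B \<in> sets T} b"
      using pull[OF f U] pull[OF g V] by (auto split: bool.split)
  qed
  then show ?thesis
    using U V f g by (auto simp: indep_pair_def)
qed

text \<open>Conditionally on the multipliers, the products are increasing functions of the \<open>W i\<close>, so the conditional
orthant probability is at most a product of functions of the single \<open>\<eta> i\<close>. Independence of the
\<open>\<eta> i\<close> turns the mean of this product into the product of the means. Nonnegativity of the
multipliers is what keeps the direction of the dependence.\<close>
lemma (in prob_space) upper_orthant_dependent_mult_indep:
  fixes W \<eta> :: "'i \<Rightarrow> 'a \<Rightarrow> real"
  assumes UO: "upper_orthant_dependent I W"
    and \<eta>: "indep_vars (\<lambda>_. borel) \<eta> I" "\<And>i \<omega>. i \<in> I \<Longrightarrow> 0 \<le> \<eta> i \<omega>"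
    and indep: "indep_pair M (PiM I (\<lambda>_. borel)) (\<lambda>\<omega>. \<lambda>i\<in>I. W i \<omega>) (PiM I (\<lambda>_. borel)) (\<lambda>\<omega>. \<lambda>i\<in>I. \<eta> i \<omega>)"
  shows "upper_orthant_dependent I (\<lambda>i \<omega>. W i \<omega> * \<eta> i \<omega>)"
  unfolding upper_orthant_dependent_def
proof (intro conjI allI impI ballI)
  show fin: "finite I" using UO by (simp add: upper_orthant_dependent_def)
  have W_meas [measurable]: "W i \<in> borel_measurable M" if "i \<in> I" for i
    using UO that by (simp add: upper_orthant_dependent_def)
  have \<eta>_meas [measurable]: "\<eta> i \<in> borel_measurable M" if "i \<in> I" for i
    using \<eta>(1) that by (simp add: indep_vars_def)
  show "(\<lambda>\<omega>. W i \<omega> * \<eta> i \<omega>) \<in> borel_measurable M" if "i \<in> I" for i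
    using that by measurable
  fix J and s :: "'i \<Rightarrow> real" assume J: "J \<subseteq> I"
  define g where "g i x = (\<integral>\<^sup>+\<omega>. (if s i < W i \<omega> * x then 1 else 0) \<partial>M)" for i x
  have g_meas: "g i \<in> borel_measurable borel" if "i \<in> I" for i
    unfolding g_def using that by measurable
  have em: "emeasure M {\<omega> \<in> space M. Q \<omega>} = (\<integral>\<^sup>+\<omega>. (if Q \<omega> then 1 else 0) \<partial>M)" 
    if "{\<omega> \<in> space M. Q \<omega>} \<in> events" for Q
    by (subst nn_integral_indicator[OF that, symmetric]) (auto intro!: nn_integral_cong simp: indicator_def)
  have sets: "{\<omega> \<in> space M. \<forall>i\<in>K. s i < W i \<omega> * x i \<omega>} \<in> events" 
    if "K \<subseteq> I" "\<And>i. i \<in> K \<Longrightarrow> x i \<in> borel_measurable M" for K x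
    using that finite_subset[OF that(1) fin] W_meas
    by (intro sets.sets_Collect_finite_All borel_measurable_less borel_measurable_times) (auto simp: subset_iff)
  have fubini: "emeasure M {\<omega> \<in> space M. \<forall>i\<in>K. s i < W i \<omega> * \<eta> i \<omega>} =
      (\<integral>\<^sup>+\<omega>'. emeasure M {\<omega> \<in> space M. \<forall>i\<in>K. s i < W i \<omega> * \<eta> i \<omega>'} \<partial>M)" if "K \<subseteq> I" for K
  proof -
    have finK: "finite K" using that fin by (rule finite_subset)
    define f :: "('i \<Rightarrow> real) \<times> ('i \<Rightarrow> real) \<Rightarrow> ennreal" where
      "f = (\<lambda>(w, x). if \<forall>i\<in>K. s i < w i * x i then 1 else 0)"
    have "f \<in> borel_measurable (PiM I (\<lambda>_. borel) \<Otimes>\<^sub>M PiM I (\<lambda>_. borel))"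
      unfolding f_def case_prod_beta using finK that
      by (intro measurable_If measurable_const sets.sets_Collect_finite_All borel_measurable_less
          borel_measurable_times measurable_compose[OF measurable_fst measurable_component_singleton]
          measurable_compose[OF measurable_snd measurable_component_singleton]) auto
    from indep_pair_nn_integral[OF indep this]
    have "(\<integral>\<^sup>+\<omega>. (if \<forall>i\<in>K. s i < W i \<omega> * \<eta> i \<omega> then 1 else 0) \<partial>M) =
        (\<integral>\<^sup>+\<omega>'. \<integral>\<^sup>+\<omega>. (if \<forall>i\<in>K. s i < W i \<omega> * \<eta> i \<omega>' then 1 else 0) \<partial>M \<partial>M)"
      using that by (simp add: f_def subset_iff cong: ball_cong)
    then show ?thesis
      using that by (subst (1 2) em) (auto intro!: sets)
  qed
  have single: "(\<integral>\<^sup>+\<omega>'. g i (\<eta> i \<omega>') \<partial>M) = emeasure M {\<omega> \<in> space M. s i < W i \<omega> * \<eta> i \<omega>}" if "i \<in> I" for i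
  proof -
    have "emeasure M {\<omega> \<in> space M. s i < W i \<omega> * x} = g i x" for x
      unfolding g_def using that by (intro em) measurable
    then show ?thesis using fubini[of "{i}"] that by simp
  qed
  have "emeasure M {\<omega> \<in> space M. \<forall>i\<in>J. s i < W i \<omega> * \<eta> i \<omega>} =
      (\<integral>\<^sup>+\<omega>'. emeasure M {\<omega> \<in> space M. \<forall>i\<in>J. s i < W i \<omega> * \<eta> i \<omega>'} \<partial>M)"
    by (rule fubini[OF J])
  also have "\<dots> \<le> (\<integral>\<^sup>+\<omega>'. (\<Prod>i\<in>J. g i (\<eta> i \<omega>')) \<partial>M)"
  proof (rule nn_integral_mono)
    fix \<omega>'
    have "upper_orthant_dependent I (\<lambda>i \<omega>. W i \<omega> * \<eta> i \<omega>')"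
      using \<eta>(2) by (intro upper_orthant_dependent_mono[OF UO, where f = "\<lambda>i z. z * \<eta> i \<omega>'"] continuous_intros)
        (auto intro!: monoI mult_right_mono)
    then have "prob {\<omega> \<in> space M. \<forall>i\<in>J. s i < W i \<omega> * \<eta> i \<omega>'} \<le> (\<Prod>i\<in>J. prob {\<omega> \<in> space M. s i < W i \<omega> * \<eta> i \<omega>'})"
      using J unfolding upper_orthant_dependent_def by blast
    then have "emeasure M {\<omega> \<in> space M. \<forall>i\<in>J. s i < W i \<omega> * \<eta> i \<omega>'} \<le> (\<Prod>i\<in>J. ennreal (prob {\<omega> \<in> space M. s i < W i \<omega> * \<eta> i \<omega>'}))"
      by (simp add: emeasure_eq_measure prod_ennreal ennreal_leI)
    also have "\<dots> = (\<Prod>i\<in>J. g i (\<eta> i \<omega>'))"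
    proof (rule prod.cong[OF refl])
      fix i assume "i \<in> J"
      then have "i \<in> I" using J by blast
      then show "ennreal (prob {\<omega> \<in> space M. s i < W i \<omega> * \<eta> i \<omega>'}) = g i (\<eta> i \<omega>')"
        unfolding g_def emeasure_eq_measure[symmetric] by (intro em) measurable
    qed
    finally show "emeasure M {\<omega> \<in> space M. \<forall>i\<in>J. s i < W i \<omega> * \<eta> i \<omega>'} \<le> (\<Prod>i\<in>J. g i (\<eta> i \<omega>'))" .
  qed
  also have "\<dots> = (\<Prod>i\<in>J. \<integral>\<^sup>+\<omega>'. g i (\<eta> i \<omega>') \<partial>M)"
    using J g_meas finite_subset[OF J fin]
    by (intro indep_vars_nn_integral indep_vars_compose2[OF indep_vars_subset[OF \<eta>(1) J]]) auto
  also have "\<dots> = (\<Prod>i\<in>J. ennreal (prob {\<omega> \<in> space M. s i < W i \<omega> * \<eta> i \<omega>}))"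
    using J by (intro prod.cong) (auto simp: single subset_iff emeasure_eq_measure)
  finally show "prob {\<omega> \<in> space M. \<forall>i\<in>J. s i < W i \<omega> * \<eta> i \<omega>} \<le> (\<Prod>i\<in>J. prob {\<omega> \<in> space M. s i < W i \<omega> * \<eta> i \<omega>})"
    by (simp add: emeasure_eq_measure prod_ennreal prod_nonneg ennreal_le_iff)
qed

section \<open>Exponential moments and a Fuk-Nagaev inequality\<close>

text \<open>The layer cake formula replaces one factor at a time by indicators of the events on which it exceeds a
level: the claim carried through the induction mixes factors already restored (in \<open>K\<close>) with
indicators (in \<open>J\<close>), and without restored factors it is upper orthant dependence itself.\<close>
lemma (in prob_space) upper_orthant_dependent_nn_integral_prod_le:
  assumes UO: "upper_orthant_dependent I V" and nonneg: "\<And>i \<omega>. i \<in> I \<Longrightarrow> 0 \<le> V i \<omega>"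
  shows "(\<integral>\<^sup>+\<omega>. (\<Prod>i\<in>I. ennreal (V i \<omega>)) \<partial>M) \<le> (\<Prod>i\<in>I. \<integral>\<^sup>+\<omega>. ennreal (V i \<omega>) \<partial>M)"
proof -
  have "finite I" using UO by (simp add: upper_orthant_dependent_def)
  have meas: "V i \<in> borel_measurable M" if "i \<in> I" for i
    using UO that by (simp add: upper_orthant_dependent_def)
  interpret pair_sigma_finite M lborel
    by (intro pair_sigma_finite.intro sigma_finite_measure_axioms sigma_finite_lborel)
  define A where "A J y = {\<omega> \<in> space M. \<forall>i\<in>J. y i < V i \<omega>}" for J and y :: "'b \<Rightarrow> real"
  have A_meas [measurable]: "A J y \<in> events" if "J \<subseteq> I" for J y
    unfolding A_def using that meas finite_subset[OF that \<open>finite I\<close>]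
    by (intro sets.sets_Collect_finite_All) auto
  have "(\<integral>\<^sup>+\<omega>. (\<Prod>i\<in>K. ennreal (V i \<omega>)) * indicator (A J y) \<omega> \<partial>M) \<le>
     (\<Prod>i\<in>K. \<integral>\<^sup>+\<omega>. ennreal (V i \<omega>) \<partial>M) * (\<Prod>i\<in>J. ennreal (prob {\<omega> \<in> space M. y i < V i \<omega>}))"
    if "K \<subseteq> I" "J \<subseteq> I - K" for K J y
    using finite_subset[OF \<open>K \<subseteq> I\<close> \<open>finite I\<close>] that
  proof (induction K arbitrary: J y rule: finite_induct)
    case empty
    have "prob (A J y) \<le> (\<Prod>i\<in>J. prob {\<omega> \<in> space M. y i < V i \<omega>})"
      using UO empty unfolding A_def upper_orthant_dependent_def by simp
    then have "ennreal (prob (A J y)) \<le> ennreal (\<Prod>i\<in>J. prob {\<omega> \<in> space M. y i < V i \<omega>})"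
      by (rule ennreal_leI)
    then show ?case
      using A_meas[of J y] empty by (simp add: emeasure_eq_measure prod_ennreal)
  next
    case (insert k K)
    have kI: "k \<in> I" and KI: "K \<subseteq> I" and JI: "J \<subseteq> I" and kJ: "k \<notin> J" "finite J"
      using insert.prems finite_subset[OF _ \<open>finite I\<close>] by auto
    define G where "G \<omega> = (\<Prod>i\<in>K. ennreal (V i \<omega>)) * indicator (A J y) \<omega>" for \<omega>
    define E where "E = (\<Prod>i\<in>K. \<integral>\<^sup>+\<omega>. ennreal (V i \<omega>) \<partial>M) * (\<Prod>i\<in>J. ennreal (prob {\<omega> \<in> space M. y i < V i \<omega>}))"
    have [measurable]: "G \<in> borel_measurable M"
      unfolding G_def using meas KI A_meas[OF JI]
      by (intro borel_measurable_times_ennreal borel_measurable_prod_ennreal measurable_compose[OF _ measurable_ennreal]) auto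
    have [measurable]: "V k \<in> borel_measurable M" using meas kI by simp
    \<comment> \<open>The layer cake formula for the factor \<open>k\<close>, and the resulting exchange of integrals.\<close>
    have layer: "ennreal (V k \<omega>) = (\<integral>\<^sup>+s. indicator {0..<V k \<omega>} s \<partial>lborel)" for \<omega>
      using nonneg[OF kI] by simp
    have swap: "(\<integral>\<^sup>+\<omega>. ennreal (V k \<omega>) * F \<omega> \<partial>M) =
        (\<integral>\<^sup>+s. indicator {0..} s * (\<integral>\<^sup>+\<omega>. F \<omega> * indicator {\<omega> \<in> space M. s < V k \<omega>} \<omega> \<partial>M) \<partial>lborel)"
      if [measurable]: "F \<in> borel_measurable M" for F :: "'a \<Rightarrow> ennreal"
    proof -
      have "(\<integral>\<^sup>+\<omega>. ennreal (V k \<omega>) * F \<omega> \<partial>M) =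
          (\<integral>\<^sup>+\<omega>. (\<integral>\<^sup>+s. indicator {0..} s * (F \<omega> * (if s < V k \<omega> then 1 else 0)) \<partial>lborel) \<partial>M)"
        unfolding layer
        by (subst nn_integral_multc[symmetric])
          (auto intro!: nn_integral_cong simp: indicator_def)
      also have "\<dots> = (\<integral>\<^sup>+s. (\<integral>\<^sup>+\<omega>. indicator {0..} s * (F \<omega> * (if s < V k \<omega> then 1 else 0)) \<partial>M) \<partial>lborel)"
        by (rule Fubini'[symmetric]) measurable
      also have "\<dots> = (\<integral>\<^sup>+s. indicator {0..} s * (\<integral>\<^sup>+\<omega>. F \<omega> * indicator {\<omega> \<in> space M. s < V k \<omega>} \<omega> \<partial>M) \<partial>lborel)"
        by (subst nn_integral_cmult[symmetric])
          (auto intro!: nn_integral_cong simp: indicator_def)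
      finally show ?thesis .
    qed
    have "(\<integral>\<^sup>+\<omega>. (\<Prod>i\<in>insert k K. ennreal (V i \<omega>)) * indicator (A J y) \<omega> \<partial>M) =
        (\<integral>\<^sup>+\<omega>. ennreal (V k \<omega>) * G \<omega> \<partial>M)"
      using insert.hyps by (simp add: G_def mult.assoc)
    also have "\<dots> = (\<integral>\<^sup>+s. indicator {0..} s * (\<integral>\<^sup>+\<omega>. G \<omega> * indicator {\<omega> \<in> space M. s < V k \<omega>} \<omega> \<partial>M) \<partial>lborel)"
      by (rule swap) measurable
    also have "\<dots> \<le> (\<integral>\<^sup>+s. indicator {0..} s * (\<integral>\<^sup>+\<omega>. E * indicator {\<omega> \<in> space M. s < V k \<omega>} \<omega> \<partial>M) \<partial>lborel)"
    proof (rule nn_integral_mono, rule mult_left_mono)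
      fix s :: real
      have A_eq: "indicator (A J y) \<omega> * indicator {\<omega> \<in> space M. s < V k \<omega>} \<omega> =
          (indicator (A (insert k J) (y(k := s))) \<omega> :: ennreal)" for \<omega>
        using kJ by (auto simp: A_def indicator_def)
      have prod_J: "(\<Prod>i\<in>J. ennreal (prob {\<omega> \<in> space M. (y(k := s)) i < V i \<omega>})) =
          (\<Prod>i\<in>J. ennreal (prob {\<omega> \<in> space M. y i < V i \<omega>}))"
        using kJ by (intro prod.cong) auto
      have "(\<integral>\<^sup>+\<omega>. G \<omega> * indicator {\<omega> \<in> space M. s < V k \<omega>} \<omega> \<partial>M) =
          (\<integral>\<^sup>+\<omega>. (\<Prod>i\<in>K. ennreal (V i \<omega>)) * indicator (A (insert k J) (y(k := s))) \<omega> \<partial>M)"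
        unfolding G_def mult.assoc A_eq ..
      also have "\<dots> \<le> (\<Prod>i\<in>K. \<integral>\<^sup>+\<omega>. ennreal (V i \<omega>) \<partial>M) *
          (\<Prod>i\<in>insert k J. ennreal (prob {\<omega> \<in> space M. (y(k := s)) i < V i \<omega>}))"
        using insert.prems insert.hyps by (intro insert.IH) auto
      also have "(\<Prod>i\<in>insert k J. ennreal (prob {\<omega> \<in> space M. (y(k := s)) i < V i \<omega>})) =
          ennreal (prob {\<omega> \<in> space M. s < V k \<omega>}) * (\<Prod>i\<in>J. ennreal (prob {\<omega> \<in> space M. y i < V i \<omega>}))"
        using kJ prod_J by simp
      also have "(\<Prod>i\<in>K. \<integral>\<^sup>+\<omega>. ennreal (V i \<omega>) \<partial>M) * \<dots> = E * emeasure M {\<omega> \<in> space M. s < V k \<omega>}"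
        by (simp add: E_def emeasure_eq_measure ac_simps)
      also have "\<dots> = (\<integral>\<^sup>+\<omega>. E * indicator {\<omega> \<in> space M. s < V k \<omega>} \<omega> \<partial>M)"
        by (simp add: nn_integral_cmult_indicator)
      finally show "(\<integral>\<^sup>+\<omega>. G \<omega> * indicator {\<omega> \<in> space M. s < V k \<omega>} \<omega> \<partial>M) \<le>
          (\<integral>\<^sup>+\<omega>. E * indicator {\<omega> \<in> space M. s < V k \<omega>} \<omega> \<partial>M)" .
    qed simp
    also have "\<dots> = (\<integral>\<^sup>+\<omega>. ennreal (V k \<omega>) * E \<partial>M)"
      by (rule swap[symmetric]) measurable
    also have "\<dots> = (\<integral>\<^sup>+\<omega>. ennreal (V k \<omega>) \<partial>M) * E"
      by (rule nn_integral_multc) measurable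
    finally show ?case
      using insert.hyps by (simp add: E_def mult.assoc)
  qed
  from this[of I "{}"] show ?thesis
    by (simp add: A_def cong: nn_integral_cong)
qed

text \<open>The function $(e^u - 1 - u)/u^2$ is increasing. For nonnegative arguments this is seen term by term
in its power series; for \<open>u < 0 < v\<close> its value is at most $1/2$ at \<open>u\<close> and at least $1/2$ at \<open>v\<close>.\<close>
lemma exp_minus_linear_quadratic_mono:
  fixes u v :: real
  assumes "u \<le> v" "0 < v"
  shows "(exp u - 1 - u) * v\<^sup>2 \<le> (exp v - 1 - v) * u\<^sup>2"
proof (cases "0 \<le> u")
  case True
  have sums: "(\<lambda>k. w ^ (k + 2) / fact (k + 2)) sums (exp w - 1 - w)" for w :: real
  proof -
    have "(\<lambda>k. w ^ k / fact k) sums exp w"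
      using exp_converges[of w] by (simp add: divide_inverse_commute scaleR_conv_of_real)
    from sums_split_initial_segment[OF this, of 2] show ?thesis
      by (simp add: numeral_2_eq_2 algebra_simps)
  qed
  have "(exp u - 1 - u) * v\<^sup>2 \<le> (exp v - 1 - v) * u\<^sup>2"
  proof (rule sums_le[OF _ sums_mult2[OF sums[of u]] sums_mult2[OF sums[of v]]])
    fix k
    have "u ^ k * (u\<^sup>2 * v\<^sup>2 / fact (k + 2)) \<le> v ^ k * (u\<^sup>2 * v\<^sup>2 / fact (k + 2))"
      using True assms by (intro mult_right_mono power_mono) auto
    then show "u ^ (k + 2) / fact (k + 2) * v\<^sup>2 \<le> v ^ (k + 2) / fact (k + 2) * u\<^sup>2"
      by (simp add: power_add power2_eq_square mult_ac)
  qed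
  then show ?thesis .
next
  case False
  have neg: "exp u - 1 - u \<le> u\<^sup>2 / 2"
  proof -
    define w where "w = - u"
    have w: "0 < w" using False by (simp add: w_def)
    have "1 \<le> (1 - w + w\<^sup>2 / 2) * (1 + w + w\<^sup>2 / 2)"
      using w by (simp add: algebra_simps power2_eq_square)
    also have "\<dots> \<le> (1 - w + w\<^sup>2 / 2) * exp w"
    proof (rule mult_left_mono)
      show "1 + w + w\<^sup>2 / 2 \<le> exp w" using exp_lower_Taylor_quadratic[of w] w by simp
      have "0 \<le> ((1 - w)\<^sup>2 + 1) / 2" by simp
      then show "0 \<le> 1 - w + w\<^sup>2 / 2" by (simp add: power2_eq_square field_simps)
    qed
    finally have "exp (- w) \<le> 1 - w + w\<^sup>2 / 2"
      by (simp add: exp_minus field_simps)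
    then show ?thesis by (simp add: w_def)
  qed
  have pos: "v\<^sup>2 / 2 \<le> exp v - 1 - v"
    using exp_lower_Taylor_quadratic[of v] assms by simp
  have "(exp u - 1 - u) * v\<^sup>2 \<le> u\<^sup>2 / 2 * v\<^sup>2" by (intro mult_right_mono neg) simp
  also have "\<dots> = v\<^sup>2 / 2 * u\<^sup>2" by simp
  also have "\<dots> \<le> (exp v - 1 - v) * u\<^sup>2" by (intro mult_right_mono pos) simp
  finally show ?thesis .
qed

text \<open>The summands, centred and capped at \<open>y\<close>, can only differ from the uncapped ones if some centred
summand exceeds \<open>y\<close>, which accounts for the first sum. The capped sum is handled by
Chernoff's method: its exponential moment factorises up to an inequality, because capping and
exponentiating are increasing, and each factor is controlled by a variance.\<close>
lemma (in prob_space) upper_orthant_dependent_fuk_nagaev: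
  fixes x y B :: real
  assumes UO: "upper_orthant_dependent I Y"
    and square: "\<And>i. i \<in> I \<Longrightarrow> integrable M (\<lambda>\<omega>. (Y i \<omega>)\<^sup>2)"
    and B: "(\<Sum>i\<in>I. variance (Y i)) \<le> B" "0 < B" and x: "0 < x" and y: "0 < y"
  shows "prob {\<omega> \<in> space M. x < (\<Sum>i\<in>I. Y i \<omega> - expectation (Y i))} \<le>
    (\<Sum>i\<in>I. prob {\<omega> \<in> space M. y < Y i \<omega> - expectation (Y i)}) +
    exp (x / y) * (B / (x * y)) powr (x / y)"
proof -
  have fin: "finite I" using UO by (simp add: upper_orthant_dependent_def)
  have meas [measurable]: "Y i \<in> borel_measurable M" if "i \<in> I" for i
    using UO that by (simp add: upper_orthant_dependent_def)
  have int: "integrable M (Y i)" if "i \<in> I" for i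
    using square_integrable_imp_integrable[OF meas square] that by blast
  define Z where "Z i \<omega> = Y i \<omega> - expectation (Y i)" for i \<omega>
  have Z_meas [measurable]: "Z i \<in> borel_measurable M" if "i \<in> I" for i
    unfolding Z_def using that by measurable
  \<comment> \<open>The minimiser of $-\tau x + B (e^{\tau y} - 1 - \tau y)/y^2$.\<close>
  define \<tau> where "\<tau> = ln (1 + x * y / B) / y"
  define \<kappa> where "\<kappa> = (exp (\<tau> * y) - 1 - \<tau> * y) / y\<^sup>2"
  have xyB: "0 < x * y / B" using x y B by simp
  have \<tau>: "0 < \<tau>" using xyB y by (simp add: \<tau>_def)
  have exp_\<tau>: "exp (\<tau> * y) = 1 + x * y / B"
    using y xyB by (simp add: \<tau>_def)
  have \<kappa>: "0 \<le> \<kappa>"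
    unfolding \<kappa>_def using exp_ge_add_one_self[of "\<tau> * y"]
    by (intro divide_nonneg_nonneg zero_le_power2) linarith
  have pointwise: "exp (\<tau> * min z y) \<le> 1 + \<tau> * z + \<kappa> * z\<^sup>2" for z
  proof -
    let ?m = "min z y"
    have "(exp (\<tau> * ?m) - 1 - \<tau> * ?m) * (\<tau> * y)\<^sup>2 \<le> (exp (\<tau> * y) - 1 - \<tau> * y) * (\<tau> * ?m)\<^sup>2"
      using \<tau> y by (intro exp_minus_linear_quadratic_mono) auto
    then have "(exp (\<tau> * ?m) - 1 - \<tau> * ?m) * y\<^sup>2 \<le> (exp (\<tau> * y) - 1 - \<tau> * y) * ?m\<^sup>2"
      using \<tau> by (simp add: power_mult_distrib)
    then have "exp (\<tau> * ?m) - 1 - \<tau> * ?m \<le> \<kappa> * ?m\<^sup>2"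
      using y by (simp add: \<kappa>_def field_simps)
    moreover have "\<kappa> * ?m\<^sup>2 \<le> \<kappa> * z\<^sup>2"
      using \<kappa> y by (intro mult_left_mono) (auto simp: min_def intro: power_mono)
    moreover have "\<tau> * ?m \<le> \<tau> * z" using \<tau> by simp
    ultimately show ?thesis by linarith
  qed
  have factor: "(\<integral>\<^sup>+\<omega>. ennreal (exp (\<tau> * min (Z i \<omega>) y)) \<partial>M) \<le> ennreal (exp (\<kappa> * variance (Y i)))" if i: "i \<in> I" for i
  proof -
    have intZ: "integrable M (Z i)" unfolding Z_def using int[OF i] by simp
    have intZ2: "integrable M (\<lambda>\<omega>. (Z i \<omega>)\<^sup>2)"
      unfolding Z_def using square[OF i] int[OF i] by (simp add: power2_diff)
    have EZ: "expectation (Z i) = 0"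
      unfolding Z_def using int[OF i] prob_space by simp
    have "(\<integral>\<^sup>+\<omega>. ennreal (exp (\<tau> * min (Z i \<omega>) y)) \<partial>M) \<le> (\<integral>\<^sup>+\<omega>. ennreal (1 + \<tau> * Z i \<omega> + \<kappa> * (Z i \<omega>)\<^sup>2) \<partial>M)"
      by (intro nn_integral_mono ennreal_leI pointwise)
    also have "\<dots> = ennreal (expectation (\<lambda>\<omega>. 1 + \<tau> * Z i \<omega> + \<kappa> * (Z i \<omega>)\<^sup>2))"
    proof (rule nn_integral_eq_integral)
      show "integrable M (\<lambda>\<omega>. 1 + \<tau> * Z i \<omega> + \<kappa> * (Z i \<omega>)\<^sup>2)" using intZ intZ2 by simp
      have "0 \<le> 1 + \<tau> * z + \<kappa> * z\<^sup>2" for z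
        using pointwise[of z] exp_ge_zero[of "\<tau> * min z y"] by linarith
      then show "AE \<omega> in M. 0 \<le> 1 + \<tau> * Z i \<omega> + \<kappa> * (Z i \<omega>)\<^sup>2" by simp
    qed
    also have "expectation (\<lambda>\<omega>. 1 + \<tau> * Z i \<omega> + \<kappa> * (Z i \<omega>)\<^sup>2) = 1 + \<kappa> * variance (Y i)"
    proof -
      have "variance (Y i) = expectation (\<lambda>\<omega>. (Z i \<omega>)\<^sup>2)" by (simp add: Z_def)
      then show ?thesis using intZ intZ2 EZ prob_space by simp
    qed
    also have "\<dots> \<le> exp (\<kappa> * variance (Y i))"
      by (rule exp_ge_add_one_self)
    finally show ?thesis by (simp add: ennreal_leI)
  qed
  have UO_T: "upper_orthant_dependent I (\<lambda>i \<omega>. exp (\<tau> * min (Z i \<omega>) y))"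
    unfolding Z_def using \<tau>
    by (intro upper_orthant_dependent_mono[OF UO, where f = "\<lambda>i z. exp (\<tau> * min (z - expectation (Y i)) y)"])
      (auto intro!: continuous_intros monoI mult_left_mono min.mono)
  define S where "S \<omega> = (\<Sum>i\<in>I. min (Z i \<omega>) y)" for \<omega>
  have [measurable]: "S \<in> borel_measurable M"
    unfolding S_def using fin by measurable
  have "emeasure M {\<omega> \<in> space M. x \<le> S \<omega>} \<le>
      ennreal (exp (- \<tau> * x)) * (\<integral>\<^sup>+\<omega>. ennreal (exp (\<tau> * S \<omega>)) * indicator (space M) \<omega> \<partial>M)"
    using \<tau> by (intro Chernoff_ineq_nn_integral_ge) auto
  also have "(\<integral>\<^sup>+\<omega>. ennreal (exp (\<tau> * S \<omega>)) * indicator (space M) \<omega> \<partial>M) =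
      (\<integral>\<^sup>+\<omega>. (\<Prod>i\<in>I. ennreal (exp (\<tau> * min (Z i \<omega>) y))) \<partial>M)"
    using fin by (intro nn_integral_cong) (simp add: S_def sum_distrib_left exp_sum prod_ennreal)
  also have "\<dots> \<le> (\<Prod>i\<in>I. \<integral>\<^sup>+\<omega>. ennreal (exp (\<tau> * min (Z i \<omega>) y)) \<partial>M)"
    by (rule upper_orthant_dependent_nn_integral_prod_le[OF UO_T]) simp
  also have "\<dots> \<le> (\<Prod>i\<in>I. ennreal (exp (\<kappa> * variance (Y i))))"
    by (intro prod_mono_ennreal factor)
  also have "\<dots> = ennreal (exp (\<kappa> * (\<Sum>i\<in>I. variance (Y i))))"
    using fin by (simp add: sum_distrib_left exp_sum prod_ennreal)
  also have "\<dots> \<le> ennreal (exp (\<kappa> * B))"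
    using B \<kappa> by (intro ennreal_leI) (simp add: mult_left_mono)
  finally have "emeasure M {\<omega> \<in> space M. x \<le> S \<omega>} \<le> ennreal (exp (- \<tau> * x)) * ennreal (exp (\<kappa> * B))"
    by (simp add: mult_left_mono)
  then have chernoff: "prob {\<omega> \<in> space M. x \<le> S \<omega>} \<le> exp (- \<tau> * x) * exp (\<kappa> * B)"
    by (simp add: emeasure_eq_measure ennreal_mult'[symmetric] ennreal_le_iff)
  have exponent: "exp (- \<tau> * x) * exp (\<kappa> * B) \<le> exp (x / y) * (B / (x * y)) powr (x / y)"
  proof -
    have "\<kappa> * B \<le> x / y"
    proof -
      have "\<kappa> * B = (x * y / B - \<tau> * y) * B / y\<^sup>2" by (simp add: \<kappa>_def exp_\<tau>)
      also have "\<dots> \<le> (x * y / B) * B / y\<^sup>2"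
        using \<tau> y B by (intro divide_right_mono mult_right_mono) auto
      also have "\<dots> = x / y" using B y by (simp add: power2_eq_square)
      finally show ?thesis .
    qed
    moreover have "exp (- \<tau> * x) \<le> (B / (x * y)) powr (x / y)"
    proof -
      have "ln (x * y / B) \<le> ln (1 + x * y / B)" using xyB by simp
      then have "x / y * ln (x * y / B) \<le> x / y * ln (1 + x * y / B)"
        using x y by (intro mult_left_mono) auto
      then have "exp (- \<tau> * x) \<le> exp (- (x / y * ln (x * y / B)))" by (simp add: \<tau>_def mult.commute)
      also have "\<dots> = (B / (x * y)) powr (x / y)"
        using x y B by (simp add: powr_def ln_div ln_mult field_simps)
      finally show ?thesis .
    qed
    ultimately have "exp (- \<tau> * x) * exp (\<kappa> * B) \<le> (B / (x * y)) powr (x / y) * exp (x / y)"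
      by (intro mult_mono) auto
    then show ?thesis by (simp add: mult.commute)
  qed
  have "{\<omega> \<in> space M. x < (\<Sum>i\<in>I. Z i \<omega>)} \<subseteq> (\<Union>i\<in>I. {\<omega> \<in> space M. y < Z i \<omega>}) \<union> {\<omega> \<in> space M. x \<le> S \<omega>}"
  proof
    fix \<omega> assume \<omega>: "\<omega> \<in> {\<omega> \<in> space M. x < (\<Sum>i\<in>I. Z i \<omega>)}"
    show "\<omega> \<in> (\<Union>i\<in>I. {\<omega> \<in> space M. y < Z i \<omega>}) \<union> {\<omega> \<in> space M. x \<le> S \<omega>}"
    proof (cases "\<exists>i\<in>I. y < Z i \<omega>")
      case False
      then have "S \<omega> = (\<Sum>i\<in>I. Z i \<omega>)" unfolding S_def by (intro sum.cong) auto
      then show ?thesis using \<omega> by auto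
    qed (use \<omega> in auto)
  qed
  then have "prob {\<omega> \<in> space M. x < (\<Sum>i\<in>I. Z i \<omega>)} \<le> prob ((\<Union>i\<in>I. {\<omega> \<in> space M. y < Z i \<omega>}) \<union> {\<omega> \<in> space M. x \<le> S \<omega>})"
    using fin by (intro finite_measure_mono sets.Un sets.finite_UN) auto
  also have "\<dots> \<le> prob (\<Union>i\<in>I. {\<omega> \<in> space M. y < Z i \<omega>}) + prob {\<omega> \<in> space M. x \<le> S \<omega>}"
    using fin by (intro measure_Un_le sets.finite_UN) auto
  also have "prob (\<Union>i\<in>I. {\<omega> \<in> space M. y < Z i \<omega>}) \<le> (\<Sum>i\<in>I. prob {\<omega> \<in> space M. y < Z i \<omega>})"
    using fin by (intro finite_measure_subadditive_finite) auto
  finally show ?thesis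
    using chernoff exponent unfolding Z_def by linarith
qed

section \<open>Polynomial tails from moments\<close>

text \<open>The first summand pays for single large variables, the second is the Chernoff term for the rest.\<close>
definition moment_tail_const :: "real \<Rightarrow> real \<Rightarrow> real" where
  "moment_tail_const q K = 2 * q powr q * K + exp (q / 2) * (q * (1 + K) / 2) powr (q / 2)"

lemma (in prob_space) integrable_powr_mono:
  fixes f :: "'a \<Rightarrow> real"
  assumes [measurable]: "f \<in> borel_measurable M"
    and int: "integrable M (\<lambda>\<omega>. \<bar>f \<omega>\<bar> powr q)" and q: "0 \<le> r" "r \<le> q"
  shows "integrable M (\<lambda>\<omega>. \<bar>f \<omega>\<bar> powr r)"
    and "expectation (\<lambda>\<omega>. \<bar>f \<omega>\<bar> powr r) \<le> 1 + expectation (\<lambda>\<omega>. \<bar>f \<omega>\<bar> powr q)"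
proof -
  have le: "\<bar>z\<bar> powr r \<le> 1 + \<bar>z\<bar> powr q" for z :: real
  proof (cases "\<bar>z\<bar> \<le> 1")
    case True
    then have "\<bar>z\<bar> powr r \<le> 1" using q by (intro powr_le1) auto
    then show ?thesis using powr_ge_zero[of "\<bar>z\<bar>" q] by linarith
  next
    case False
    then have "\<bar>z\<bar> powr r \<le> \<bar>z\<bar> powr q" using q by (intro powr_mono) auto
    then show ?thesis by simp
  qed
  have intb: "integrable M (\<lambda>\<omega>. 1 + \<bar>f \<omega>\<bar> powr q)" using int by simp
  show *: "integrable M (\<lambda>\<omega>. \<bar>f \<omega>\<bar> powr r)"
    by (rule Bochner_Integration.integrable_bound[OF intb]) (use le in \<open>auto intro!: AE_I2 order.trans[OF le]\<close>)
  have "expectation (\<lambda>\<omega>. \<bar>f \<omega>\<bar> powr r) \<le> expectation (\<lambda>\<omega>. 1 + \<bar>f \<omega>\<bar> powr q)"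
    by (intro integral_mono * intb le)
  then show "expectation (\<lambda>\<omega>. \<bar>f \<omega>\<bar> powr r) \<le> 1 + expectation (\<lambda>\<omega>. \<bar>f \<omega>\<bar> powr q)"
    using int prob_space by simp
qed

text \<open>Jensen's inequality, obtained by integrating the tangent of $z^q$ at the mean of \<open>\<bar>f\<bar>\<close>. The
tangent inequality is needed on the closed half-line, since \<open>f\<close> may vanish.\<close>
lemma (in prob_space) abs_expectation_powr_le:
  fixes f :: "'a \<Rightarrow> real"
  assumes [measurable]: "f \<in> borel_measurable M"
    and int: "integrable M (\<lambda>\<omega>. \<bar>f \<omega>\<bar> powr q)" and q: "1 \<le> q"
  shows "\<bar>expectation f\<bar> powr q \<le> expectation (\<lambda>\<omega>. \<bar>f \<omega>\<bar> powr q)"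
proof -
  have "integrable M (\<lambda>\<omega>. \<bar>f \<omega>\<bar> powr 1)" using q by (intro integrable_powr_mono[OF _ int]) auto
  then have int1: "integrable M (\<lambda>\<omega>. \<bar>f \<omega>\<bar>)" by simp
  define m where "m = expectation (\<lambda>\<omega>. \<bar>f \<omega>\<bar>)"
  have "m powr q \<le> expectation (\<lambda>\<omega>. \<bar>f \<omega>\<bar> powr q)"
  proof (cases "m = 0")
    case False
    then have m: "0 < m" unfolding m_def by (simp add: less_le)
    have tangent: "m powr q + q * m powr (q - 1) * (z - m) \<le> z powr q" if "0 \<le> z" for z
    proof (cases "z = 0")
      case True
      have "m powr q = m powr (q - 1) * m" using m by (simp add: powr_diff)
      then show ?thesis using True q m by (simp add: mult_le_cancel_right)
    next
      case False
      then have z: "0 < z" using that by simp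
      have "q * m powr (q - 1) * (z - m) \<le> z powr q - m powr q"
      proof (rule convex_on_imp_above_tangent[where A = "{0<..}"])
        show "convex_on {0<..} (\<lambda>x. x powr q)" using q by (rule powr_convex)
        show "connected {0::real<..}" by (rule connected_Ioi)
        show "((\<lambda>x. x powr q) has_field_derivative q * m powr (q - 1)) (at m within {0<..})"
          using m by (rule has_field_derivative_at_within[OF has_real_derivative_powr])
      qed (use m z in \<open>auto simp: interior_open\<close>)
      then show ?thesis by simp
    qed
    have "m powr q = expectation (\<lambda>\<omega>. m powr q + q * m powr (q - 1) * (\<bar>f \<omega>\<bar> - m))"
      using int1 prob_space by (simp add: m_def)
    also have "\<dots> \<le> expectation (\<lambda>\<omega>. \<bar>f \<omega>\<bar> powr q)"
      using int1 by (intro integral_mono int tangent) auto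
    finally show ?thesis .
  qed simp
  moreover have "\<bar>expectation f\<bar> powr q \<le> m powr q"
    unfolding m_def using q by (intro powr_mono2 integral_abs_bound) auto
  ultimately show ?thesis by linarith
qed

lemma add_powr_le:
  fixes a b q :: real
  assumes "0 \<le> a" "0 \<le> b" "0 \<le> q"
  shows "(a + b) powr q \<le> 2 powr q * (a powr q + b powr q)"
proof -
  have "(a + b) powr q \<le> (2 * max a b) powr q"
    using assms by (intro powr_mono2) auto
  also have "\<dots> = 2 powr q * (max a b) powr q"
    using assms by (simp add: powr_mult)
  also have "\<dots> \<le> 2 powr q * (a powr q + b powr q)"
    by (intro mult_left_mono) (auto simp: max_def)
  finally show ?thesis .
qed

text \<open>The Fuk-Nagaev inequality with cap \<open>2 * x / q\<close>: its exponential term becomes the power \<open>q / 2\<close>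
of a quantity of order $n/x^2$, and Markov's inequality for the exponent \<open>q\<close>
makes its first sum of order $n/x^q$, which is no larger than $n^{q/2}/x^q$.\<close>
lemma (in prob_space) upper_orthant_dependent_moment_tail:
  fixes K q x :: real
  assumes UO: "upper_orthant_dependent I Y" and I: "I \<noteq> {}" and q: "2 < q"
    and int: "\<And>i. i \<in> I \<Longrightarrow> integrable M (\<lambda>\<omega>. \<bar>Y i \<omega>\<bar> powr q)"
    and K: "(\<Sum>i\<in>I. expectation (\<lambda>\<omega>. \<bar>Y i \<omega>\<bar> powr q)) \<le> K * card I" "0 \<le> K" and x: "0 < x"
  shows "prob {\<omega> \<in> space M. x < (\<Sum>i\<in>I. Y i \<omega> - expectation (Y i))} \<le>
    moment_tail_const q K * card I powr (q / 2) / x powr q"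
proof -
  have fin: "finite I" using UO by (simp add: upper_orthant_dependent_def)
  have meas [measurable]: "Y i \<in> borel_measurable M" if "i \<in> I" for i
    using UO that by (simp add: upper_orthant_dependent_def)
  define n where "n = real (card I)"
  have n: "1 \<le> n" using I fin by (simp add: n_def Suc_le_eq card_gt_0_iff)
  define y where "y = 2 * x / q"
  have y: "0 < y" and xy: "x / y = q / 2" "x * y = 2 * x\<^sup>2 / q" using x q by (auto simp: y_def power2_eq_square)
  have int2: "integrable M (\<lambda>\<omega>. (Y i \<omega>)\<^sup>2)" 
    and EY2: "expectation (\<lambda>\<omega>. (Y i \<omega>)\<^sup>2) \<le> 1 + expectation (\<lambda>\<omega>. \<bar>Y i \<omega>\<bar> powr q)" if "i \<in> I" for i
    using integrable_powr_mono[OF meas[OF that] int[OF that], of 2] q by simp_all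
  have int1: "integrable M (Y i)" if "i \<in> I" for i
    using square_integrable_imp_integrable[OF meas int2] that by blast
  have "(\<Sum>i\<in>I. variance (Y i)) \<le> (\<Sum>i\<in>I. 1 + expectation (\<lambda>\<omega>. \<bar>Y i \<omega>\<bar> powr q))"
  proof (rule sum_mono)
    fix i assume i: "i \<in> I"
    have "variance (Y i) \<le> expectation (\<lambda>\<omega>. (Y i \<omega>)\<^sup>2)"
      using variance_eq[OF int1 int2] i by simp
    then show "variance (Y i) \<le> 1 + expectation (\<lambda>\<omega>. \<bar>Y i \<omega>\<bar> powr q)"
      using EY2[OF i] by simp
  qed
  also have "\<dots> \<le> (1 + K) * n"
    using K(1) by (simp add: sum.distrib n_def algebra_simps)
  finally have var: "(\<Sum>i\<in>I. variance (Y i)) \<le> (1 + K) * n" .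
  have "prob {\<omega> \<in> space M. x < (\<Sum>i\<in>I. Y i \<omega> - expectation (Y i))} \<le>
    (\<Sum>i\<in>I. prob {\<omega> \<in> space M. y < Y i \<omega> - expectation (Y i)}) +
    exp (x / y) * ((1 + K) * n / (x * y)) powr (x / y)"
    using UO int2 var x y K n by (intro upper_orthant_dependent_fuk_nagaev) auto
  also have "exp (x / y) * ((1 + K) * n / (x * y)) powr (x / y) =
      exp (q / 2) * (q * (1 + K) / 2) powr (q / 2) * n powr (q / 2) / x powr q"
  proof -
    have "((1 + K) * n / (x * y)) powr (q / 2) = ((q * (1 + K) / 2) * n / x powr 2) powr (q / 2)"
      using x by (simp add: xy mult_ac)
    also have "\<dots> = (q * (1 + K) / 2) powr (q / 2) * n powr (q / 2) / (x powr 2) powr (q / 2)"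
      using q K n by (simp add: powr_divide powr_mult)
    also have "(x powr 2) powr (q / 2) = x powr q"
      by (simp add: powr_powr)
    finally show ?thesis unfolding xy(1) by simp
  qed
  also have "(\<Sum>i\<in>I. prob {\<omega> \<in> space M. y < Y i \<omega> - expectation (Y i)}) \<le>
      (\<Sum>i\<in>I. 2 powr q * (2 * expectation (\<lambda>\<omega>. \<bar>Y i \<omega>\<bar> powr q)) / y powr q)"
  proof (rule sum_mono)
    fix i assume i: "i \<in> I"
    define Z where "Z \<omega> = Y i \<omega> - expectation (Y i)" for \<omega>
    have [measurable]: "Z \<in> borel_measurable M" unfolding Z_def using i by measurable
    have le: "\<bar>Z \<omega>\<bar> powr q \<le> 2 powr q * (\<bar>Y i \<omega>\<bar> powr q + \<bar>expectation (Y i)\<bar> powr q)" for \<omega>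
    proof -
      have "\<bar>Z \<omega>\<bar> powr q \<le> (\<bar>Y i \<omega>\<bar> + \<bar>expectation (Y i)\<bar>) powr q"
        using q by (intro powr_mono2) (auto simp: Z_def)
      then show ?thesis using add_powr_le[of "\<bar>Y i \<omega>\<bar>" "\<bar>expectation (Y i)\<bar>" q] q by simp
    qed
    have intb: "integrable M (\<lambda>\<omega>. 2 powr q * (\<bar>Y i \<omega>\<bar> powr q + \<bar>expectation (Y i)\<bar> powr q))"
      using int[OF i] by simp
    have intZ: "integrable M (\<lambda>\<omega>. \<bar>Z \<omega>\<bar> powr q)"
      by (rule Bochner_Integration.integrable_bound[OF intb]) (auto intro!: AE_I2 order.trans[OF le])
    have "prob {\<omega> \<in> space M. y < Z \<omega>} \<le> prob {\<omega> \<in> space M. y powr q \<le> \<bar>Z \<omega>\<bar> powr q}"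
      using y q by (intro finite_measure_mono) (auto intro!: powr_mono2)
    also have "\<dots> \<le> expectation (\<lambda>\<omega>. \<bar>Z \<omega>\<bar> powr q) / y powr q"
      using y by (intro integral_Markov_inequality_measure[OF intZ, where A = "{}"]) auto
    also have "\<dots> \<le> expectation (\<lambda>\<omega>. 2 powr q * (\<bar>Y i \<omega>\<bar> powr q + \<bar>expectation (Y i)\<bar> powr q)) / y powr q"
      by (intro divide_right_mono integral_mono intZ intb le) simp
    also have "\<dots> = 2 powr q * (expectation (\<lambda>\<omega>. \<bar>Y i \<omega>\<bar> powr q) + \<bar>expectation (Y i)\<bar> powr q) / y powr q"
      using int[OF i] prob_space by simp
    also have "\<dots> \<le> 2 powr q * (2 * expectation (\<lambda>\<omega>. \<bar>Y i \<omega>\<bar> powr q)) / y powr q"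
      using abs_expectation_powr_le[OF meas[OF i] int[OF i]] q
      by (intro divide_right_mono mult_left_mono) auto
    finally show "prob {\<omega> \<in> space M. y < Y i \<omega> - expectation (Y i)} \<le>
        2 powr q * (2 * expectation (\<lambda>\<omega>. \<bar>Y i \<omega>\<bar> powr q)) / y powr q"
      unfolding Z_def .
  qed
  also have "\<dots> = 2 * q powr q / x powr q * (\<Sum>i\<in>I. expectation (\<lambda>\<omega>. \<bar>Y i \<omega>\<bar> powr q))"
    using q x by (simp add: sum_distrib_left y_def powr_divide powr_mult mult_ac)
  also have "\<dots> \<le> 2 * q powr q / x powr q * (K * n powr (q / 2))"
  proof (rule mult_left_mono)
    have "n \<le> n powr (q / 2)" using powr_mono[of 1 "q / 2" n] q n by simp
    then show "(\<Sum>i\<in>I. expectation (\<lambda>\<omega>. \<bar>Y i \<omega>\<bar> powr q)) \<le> K * n powr (q / 2)"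
      using K mult_left_mono[of n "n powr (q / 2)" K] by (simp add: n_def)
  qed simp
  finally show ?thesis
    by (simp add: moment_tail_const_def n_def add_divide_distrib distrib_right distrib_left mult_ac)
qed

section \<open>Weighted sums\<close>

lemma (in prob_space) indep_pair_expectation_mult:
  fixes f :: "'s \<Rightarrow> real" and g :: "'t \<Rightarrow> real"
  assumes indep: "indep_pair M S U T V"
    and f [measurable]: "f \<in> borel_measurable S" and g [measurable]: "g \<in> borel_measurable T"
    and nonneg: "\<And>u. 0 \<le> f u" "\<And>v. 0 \<le> g v"
    and int: "integrable M (\<lambda>\<omega>. f (U \<omega>))" "integrable M (\<lambda>\<omega>. g (V \<omega>))"
  shows "integrable M (\<lambda>\<omega>. f (U \<omega>) * g (V \<omega>))"
    and "expectation (\<lambda>\<omega>. f (U \<omega>) * g (V \<omega>)) = expectation (\<lambda>\<omega>. f (U \<omega>)) * expectation (\<lambda>\<omega>. g (V \<omega>))"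
proof -
  have [measurable]: "U \<in> measurable M S" "V \<in> measurable M T"
    using indep by (auto simp: indep_pair_def)
  have "(\<integral>\<^sup>+\<omega>. ennreal (f (U \<omega>) * g (V \<omega>)) \<partial>M) = (\<integral>\<^sup>+\<omega>'. \<integral>\<^sup>+\<omega>. ennreal (f (U \<omega>) * g (V \<omega>')) \<partial>M \<partial>M)"
    using indep_pair_nn_integral[OF indep, of "\<lambda>(u, v). ennreal (f u * g v)"] by simp
  also have "\<dots> = (\<integral>\<^sup>+\<omega>'. ennreal (expectation (\<lambda>\<omega>. f (U \<omega>))) * ennreal (g (V \<omega>')) \<partial>M)"
    by (intro nn_integral_cong)
      (simp add: ennreal_mult nonneg nn_integral_multc nn_integral_eq_integral[OF int(1)])
  also have "\<dots> = ennreal (expectation (\<lambda>\<omega>. f (U \<omega>))) * ennreal (expectation (\<lambda>\<omega>. g (V \<omega>)))"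
    by (simp add: nn_integral_cmult nonneg nn_integral_eq_integral[OF int(2)])
  also have "\<dots> = ennreal (expectation (\<lambda>\<omega>. f (U \<omega>)) * expectation (\<lambda>\<omega>. g (V \<omega>)))"
    by (simp add: ennreal_mult nonneg)
  finally have *: "(\<integral>\<^sup>+\<omega>. ennreal (f (U \<omega>) * g (V \<omega>)) \<partial>M) = \<dots>" .
  show int': "integrable M (\<lambda>\<omega>. f (U \<omega>) * g (V \<omega>))"
    by (rule integrableI_nonneg) (use * nonneg in \<open>auto simp: ennreal_less_top\<close>)
  show "expectation (\<lambda>\<omega>. f (U \<omega>) * g (V \<omega>)) = expectation (\<lambda>\<omega>. f (U \<omega>)) * expectation (\<lambda>\<omega>. g (V \<omega>))"
    using * nn_integral_eq_integral[OF int'] nonneg by simp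
qed

text \<open>Nonnegative multipliers keep the products upper orthant dependent, and independence factorises their moments, so
the tail bound applies to the products with the product of the two moment bounds.\<close>
lemma (in prob_space) weighted_sum_moment_tail:
  fixes W :: "'i \<Rightarrow> 'a \<Rightarrow> real" and h :: "'x \<Rightarrow> real" and K L x :: real
  assumes UO: "upper_orthant_dependent I W" and I: "I \<noteq> {}" and q: "2 < q"
    and intW: "\<And>i. i \<in> I \<Longrightarrow> integrable M (\<lambda>\<omega>. \<bar>W i \<omega>\<bar> powr q)"
    and sumW: "(\<Sum>i\<in>I. expectation (\<lambda>\<omega>. \<bar>W i \<omega>\<bar> powr q)) \<le> K * card I"
    and X: "indep_vars (\<lambda>_. N) X I"
    and indep: "indep_pair M (PiM I (\<lambda>_. borel)) (\<lambda>\<omega>. \<lambda>i\<in>I. W i \<omega>) (PiM I (\<lambda>_. N)) (\<lambda>\<omega>. \<lambda>i\<in>I. X i \<omega>)"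
    and h: "h \<in> borel_measurable N" "\<And>x. 0 \<le> h x"
    and inth: "\<And>i. i \<in> I \<Longrightarrow> integrable M (\<lambda>\<omega>. h (X i \<omega>) powr q)"
    and L: "\<And>i. i \<in> I \<Longrightarrow> expectation (\<lambda>\<omega>. h (X i \<omega>) powr q) \<le> L"
    and K: "0 \<le> K" "0 \<le> L" and x: "0 < x"
  shows "\<And>i. i \<in> I \<Longrightarrow> integrable M (\<lambda>\<omega>. W i \<omega> * h (X i \<omega>))"
    and "prob {\<omega> \<in> space M. x < (\<Sum>i\<in>I. W i \<omega> * h (X i \<omega>) - expectation (\<lambda>\<omega>. W i \<omega> * h (X i \<omega>)))} \<le>
      moment_tail_const q (K * L) * card I powr (q / 2) / x powr q"
proof -
  have h_meas [measurable]: "h \<in> borel_measurable N" by fact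
  have X_meas [measurable]: "X i \<in> measurable M N" if "i \<in> I" for i
    using X that by (simp add: indep_vars_def)
  have W_meas [measurable]: "W i \<in> borel_measurable M" if "i \<in> I" for i
    using UO that by (simp add: upper_orthant_dependent_def)
  have UO_prod: "upper_orthant_dependent I (\<lambda>i \<omega>. W i \<omega> * h (X i \<omega>))"
  proof (rule upper_orthant_dependent_mult_indep[OF UO])
    show "indep_vars (\<lambda>_. borel) (\<lambda>i \<omega>. h (X i \<omega>)) I"
      using X by (rule indep_vars_compose2) (use h in simp)
    have "(\<lambda>v. \<lambda>i\<in>I. h (v i)) \<in> measurable (PiM I (\<lambda>_. N)) (PiM I (\<lambda>_. borel))"
      by measurable
    from indep_pair_compose[OF indep measurable_ident this]
    show "indep_pair M (PiM I (\<lambda>_. borel)) (\<lambda>\<omega>. \<lambda>i\<in>I. W i \<omega>) (PiM I (\<lambda>_. borel)) (\<lambda>\<omega>. \<lambda>i\<in>I. h (X i \<omega>))"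
      by (simp cong: restrict_cong)
  qed (use h in simp)
  have moment: "integrable M (\<lambda>\<omega>. \<bar>W i \<omega> * h (X i \<omega>)\<bar> powr q)"
    "expectation (\<lambda>\<omega>. \<bar>W i \<omega> * h (X i \<omega>)\<bar> powr q) \<le> expectation (\<lambda>\<omega>. \<bar>W i \<omega>\<bar> powr q) * L" if i: "i \<in> I" for i
  proof -
    have eq: "\<bar>W i \<omega> * h (X i \<omega>)\<bar> powr q = \<bar>W i \<omega>\<bar> powr q * h (X i \<omega>) powr q" for \<omega>
      using h(2) by (simp add: abs_mult powr_mult)
    have ind: "indep_pair M borel (W i) N (X i)"
      using indep_pair_compose[OF indep measurable_component_singleton[OF i] measurable_component_singleton[OF i]] i
      by simp
    note * = indep_pair_expectation_mult[OF ind, of "\<lambda>w. \<bar>w\<bar> powr q" "\<lambda>x. h x powr q"]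
    show "integrable M (\<lambda>\<omega>. \<bar>W i \<omega> * h (X i \<omega>)\<bar> powr q)"
      unfolding eq using intW[OF i] inth[OF i] by (intro *) auto
    have "expectation (\<lambda>\<omega>. \<bar>W i \<omega> * h (X i \<omega>)\<bar> powr q) =
        expectation (\<lambda>\<omega>. \<bar>W i \<omega>\<bar> powr q) * expectation (\<lambda>\<omega>. h (X i \<omega>) powr q)"
      unfolding eq using intW[OF i] inth[OF i] by (intro *) auto
    also have "\<dots> \<le> expectation (\<lambda>\<omega>. \<bar>W i \<omega>\<bar> powr q) * L"
      by (intro mult_left_mono L i) simp
    finally show "expectation (\<lambda>\<omega>. \<bar>W i \<omega> * h (X i \<omega>)\<bar> powr q) \<le> expectation (\<lambda>\<omega>. \<bar>W i \<omega>\<bar> powr q) * L" .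
  qed
  show "integrable M (\<lambda>\<omega>. W i \<omega> * h (X i \<omega>))" if i: "i \<in> I" for i
  proof -
    have [measurable]: "(\<lambda>\<omega>. W i \<omega> * h (X i \<omega>)) \<in> borel_measurable M" using i by measurable
    have "integrable M (\<lambda>\<omega>. \<bar>W i \<omega> * h (X i \<omega>)\<bar> powr 1)"
      using q by (intro integrable_powr_mono[OF _ moment(1)[OF i]]) auto
    then have "integrable M (\<lambda>\<omega>. \<bar>W i \<omega> * h (X i \<omega>)\<bar>)" by simp
    then show ?thesis by (rule integrable_abs_cancel) measurable
  qed
  have "(\<Sum>i\<in>I. expectation (\<lambda>\<omega>. \<bar>W i \<omega> * h (X i \<omega>)\<bar> powr q)) \<le> (\<Sum>i\<in>I. expectation (\<lambda>\<omega>. \<bar>W i \<omega>\<bar> powr q) * L)"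
    by (intro sum_mono moment)
  also have "\<dots> = (\<Sum>i\<in>I. expectation (\<lambda>\<omega>. \<bar>W i \<omega>\<bar> powr q)) * L"
    by (simp add: sum_distrib_right)
  also have "\<dots> \<le> K * L * card I"
    using mult_right_mono[OF sumW K(2)] by (simp add: mult_ac)
  finally show "prob {\<omega> \<in> space M. x < (\<Sum>i\<in>I. W i \<omega> * h (X i \<omega>) - expectation (\<lambda>\<omega>. W i \<omega> * h (X i \<omega>)))} \<le>
      moment_tail_const q (K * L) * card I powr (q / 2) / x powr q"
    using K by (intro upper_orthant_dependent_moment_tail[OF UO_prod I q] moment x) auto
qed

text \<open>Splitting \<open>g\<close> into positive and negative parts makes the multipliers nonnegative. Each part
contributes two tails, the lower one through the weights \<open>- W i\<close>, so one of four one-sided deviations must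
exceed \<open>x\<close>.\<close>
lemma (in prob_space) NOD_weighted_sum_moment_tail:
  fixes W :: "'i \<Rightarrow> 'a \<Rightarrow> real" and g :: "'x \<Rightarrow> real" and K L x :: real
  assumes NOD: "neg_orthant_dependent M I W" and I: "I \<noteq> {}" and q: "2 < q"
    and intW: "\<And>i. i \<in> I \<Longrightarrow> integrable M (\<lambda>\<omega>. \<bar>W i \<omega>\<bar> powr q)"
    and sumW: "(\<Sum>i\<in>I. expectation (\<lambda>\<omega>. \<bar>W i \<omega>\<bar> powr q)) \<le> K * card I"
    and X: "indep_vars (\<lambda>_. N) X I"
    and indep: "indep_pair M (PiM I (\<lambda>_. borel)) (\<lambda>\<omega>. \<lambda>i\<in>I. W i \<omega>) (PiM I (\<lambda>_. N)) (\<lambda>\<omega>. \<lambda>i\<in>I. X i \<omega>)"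
    and g: "g \<in> borel_measurable N"
    and intg: "\<And>i. i \<in> I \<Longrightarrow> integrable M (\<lambda>\<omega>. \<bar>g (X i \<omega>)\<bar> powr q)"
    and L: "\<And>i. i \<in> I \<Longrightarrow> expectation (\<lambda>\<omega>. \<bar>g (X i \<omega>)\<bar> powr q) \<le> L"
    and K: "0 \<le> K" "0 \<le> L" and x: "0 < x"
  shows "\<And>i. i \<in> I \<Longrightarrow> integrable M (\<lambda>\<omega>. W i \<omega> * g (X i \<omega>))"
    and "prob {\<omega> \<in> space M. 2 * x < \<bar>\<Sum>i\<in>I. W i \<omega> * g (X i \<omega>) - expectation (\<lambda>\<omega>. W i \<omega> * g (X i \<omega>))\<bar>} \<le>
      4 * (moment_tail_const q (K * L) * card I powr (q / 2) / x powr q)"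
proof -
  define C where "C = moment_tail_const q (K * L) * card I powr (q / 2) / x powr q"
  have fin: "finite I" using NOD by (simp add: neg_orthant_dependent_def)
  note g [measurable]
  have X_meas [measurable]: "X i \<in> measurable M N" if "i \<in> I" for i
    using X that by (simp add: indep_vars_def)
  have W_meas [measurable]: "W i \<in> borel_measurable M" if "i \<in> I" for i
    using NOD that by (simp add: neg_orthant_dependent_def)
  have "(\<lambda>v. \<lambda>i\<in>I. - v i) \<in> measurable (PiM I (\<lambda>_. borel)) (PiM I (\<lambda>_. borel :: real measure))"
    by measurable
  from indep_pair_compose[OF indep this measurable_ident]
  have indep_minus: "indep_pair M (PiM I (\<lambda>_. borel)) (\<lambda>\<omega>. \<lambda>i\<in>I. - W i \<omega>) (PiM I (\<lambda>_. N)) (\<lambda>\<omega>. \<lambda>i\<in>I. X i \<omega>)"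
    by (simp cong: restrict_cong)
  define T where "T h \<omega> = (\<Sum>i\<in>I. W i \<omega> * h (X i \<omega>) - expectation (\<lambda>\<omega>. W i \<omega> * h (X i \<omega>)))" for h :: "'x \<Rightarrow> real" and \<omega>
  have part: "\<And>i. i \<in> I \<Longrightarrow> integrable M (\<lambda>\<omega>. W i \<omega> * h (X i \<omega>))"
    "prob {\<omega> \<in> space M. x < T h \<omega>} \<le> C" "prob {\<omega> \<in> space M. x < - T h \<omega>} \<le> C"
    if h [measurable]: "h \<in> borel_measurable N" and h0: "\<And>x. 0 \<le> h x" and hg: "\<And>x. h x \<le> \<bar>g x\<bar>" for h
  proof -
    have le: "h (X i \<omega>) powr q \<le> \<bar>g (X i \<omega>)\<bar> powr q" for i \<omega>
      using h0 hg q by (intro powr_mono2) auto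
    have inth: "integrable M (\<lambda>\<omega>. h (X i \<omega>) powr q)" if i: "i \<in> I" for i
    proof (rule Bochner_Integration.integrable_bound[OF intg[OF i]])
      show "(\<lambda>\<omega>. h (X i \<omega>) powr q) \<in> borel_measurable M" using i by measurable
    qed (use le in auto)
    have Lh: "expectation (\<lambda>\<omega>. h (X i \<omega>) powr q) \<le> L" if i: "i \<in> I" for i
      using integral_mono[OF inth[OF i] intg[OF i] le] L[OF i] by simp
    show "integrable M (\<lambda>\<omega>. W i \<omega> * h (X i \<omega>))" if "i \<in> I" for i
      by (rule weighted_sum_moment_tail(1)[OF upper_orthant_dependent_of_NOD[OF NOD] I q intW sumW X indep h h0 inth Lh K x that])
    show "prob {\<omega> \<in> space M. x < T h \<omega>} \<le> C"
      unfolding T_def C_def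
      by (rule weighted_sum_moment_tail(2)[OF upper_orthant_dependent_of_NOD[OF NOD] I q intW sumW X indep h h0 inth Lh K x])
    have "prob {\<omega> \<in> space M. x < (\<Sum>i\<in>I. - W i \<omega> * h (X i \<omega>) - expectation (\<lambda>\<omega>. - W i \<omega> * h (X i \<omega>)))} \<le> C"
      unfolding C_def
      by (rule weighted_sum_moment_tail(2)[OF upper_orthant_dependent_uminus_of_NOD[OF NOD] I q _ _ X indep_minus h h0 inth Lh K x])
        (use intW sumW in simp_all)
    then show "prob {\<omega> \<in> space M. x < - T h \<omega>} \<le> C"
      by (simp add: T_def sum_subtractf sum_negf)
  qed
  define gp gn where "gp z = max (g z) 0" and "gn z = max (- g z) 0" for z
  have meas_pn [measurable]: "gp \<in> borel_measurable N" "gn \<in> borel_measurable N"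
    unfolding gp_def gn_def by measurable
  have pn: "\<And>z. 0 \<le> gp z" "\<And>z. gp z \<le> \<bar>g z\<bar>" "\<And>z. 0 \<le> gn z" "\<And>z. gn z \<le> \<bar>g z\<bar>" and g_eq: "\<And>z. g z = gp z - gn z"
    by (auto simp: gp_def gn_def)
  have int_p: "integrable M (\<lambda>\<omega>. W i \<omega> * gp (X i \<omega>))" and int_n: "integrable M (\<lambda>\<omega>. W i \<omega> * gn (X i \<omega>))" if "i \<in> I" for i
    using that pn by (auto intro!: part)
  show "integrable M (\<lambda>\<omega>. W i \<omega> * g (X i \<omega>))" if "i \<in> I" for i
    using int_p[OF that] int_n[OF that] by (simp add: g_eq right_diff_distrib)
  have T_eq: "T g \<omega> = T gp \<omega> - T gn \<omega>" for \<omega>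
    unfolding T_def sum_subtractf[symmetric] using int_p int_n
    by (intro sum.cong) (auto simp: g_eq right_diff_distrib)
  have [measurable]: "T h \<in> borel_measurable M" if [measurable]: "h \<in> borel_measurable N" for h
    unfolding T_def using fin by measurable
  let ?E = "\<lambda>F. {\<omega> \<in> space M. x < F \<omega>}"
  have "prob {\<omega> \<in> space M. 2 * x < \<bar>T g \<omega>\<bar>} \<le>
      prob ((?E (T gp) \<union> ?E (\<lambda>\<omega>. - T gp \<omega>)) \<union> (?E (T gn) \<union> ?E (\<lambda>\<omega>. - T gn \<omega>)))"
    unfolding T_eq by (intro finite_measure_mono) auto
  also have "\<dots> \<le> (prob (?E (T gp)) + prob (?E (\<lambda>\<omega>. - T gp \<omega>))) + (prob (?E (T gn)) + prob (?E (\<lambda>\<omega>. - T gn \<omega>)))"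
    by (intro order.trans[OF measure_Un_le] add_mono measure_Un_le) auto
  also have "\<dots> \<le> (C + C) + (C + C)"
    using pn by (intro add_mono part) auto
  finally show "prob {\<omega> \<in> space M. 2 * x < \<bar>\<Sum>i\<in>I. W i \<omega> * g (X i \<omega>) - expectation (\<lambda>\<omega>. W i \<omega> * g (X i \<omega>))\<bar>} \<le>
      4 * (moment_tail_const q (K * L) * card I powr (q / 2) / x powr q)"
    by (simp add: T_def C_def)
qed

text \<open>Absolute values need not inherit the dependence, but the positive parts of \<open>W i\<close> and of \<open>- W i\<close> do.\<close>
lemma (in prob_space) NOD_abs_sum_moment_tail:
  fixes W :: "'i \<Rightarrow> 'a \<Rightarrow> real" and K x :: real
  assumes NOD: "neg_orthant_dependent M I W" and I: "I \<noteq> {}" and q: "2 < q"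
    and intW: "\<And>i. i \<in> I \<Longrightarrow> integrable M (\<lambda>\<omega>. \<bar>W i \<omega>\<bar> powr q)"
    and sumW: "(\<Sum>i\<in>I. expectation (\<lambda>\<omega>. \<bar>W i \<omega>\<bar> powr q)) \<le> K * card I"
    and K: "0 \<le> K" and x: "0 < x"
  shows "\<And>i. i \<in> I \<Longrightarrow> integrable M (\<lambda>\<omega>. \<bar>W i \<omega>\<bar>)"
    and "(\<Sum>i\<in>I. expectation (\<lambda>\<omega>. \<bar>W i \<omega>\<bar>)) \<le> (1 + K) * card I"
    and "prob {\<omega> \<in> space M. 2 * x + (1 + K) * card I < (\<Sum>i\<in>I. \<bar>W i \<omega>\<bar>)} \<le>
      2 * (moment_tail_const q K * card I powr (q / 2) / x powr q)"
proof -
  define C where "C = moment_tail_const q K * card I powr (q / 2) / x powr q"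
  have fin: "finite I" using NOD by (simp add: neg_orthant_dependent_def)
  have W_meas [measurable]: "W i \<in> borel_measurable M" if "i \<in> I" for i
    using NOD that by (simp add: neg_orthant_dependent_def)
  have int1: "integrable M (\<lambda>\<omega>. \<bar>W i \<omega>\<bar>)"
    and E1: "expectation (\<lambda>\<omega>. \<bar>W i \<omega>\<bar>) \<le> 1 + expectation (\<lambda>\<omega>. \<bar>W i \<omega>\<bar> powr q)" if "i \<in> I" for i
    using integrable_powr_mono[OF W_meas[OF that] intW[OF that], of 1] q by simp_all
  show "integrable M (\<lambda>\<omega>. \<bar>W i \<omega>\<bar>)" if "i \<in> I" for i using int1[OF that] .
  have "(\<Sum>i\<in>I. expectation (\<lambda>\<omega>. \<bar>W i \<omega>\<bar>)) \<le> (\<Sum>i\<in>I. 1 + expectation (\<lambda>\<omega>. \<bar>W i \<omega>\<bar> powr q))"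
    by (intro sum_mono E1)
  also have "\<dots> \<le> (1 + K) * card I"
    using sumW by (simp add: sum.distrib algebra_simps)
  finally show sum1: "(\<Sum>i\<in>I. expectation (\<lambda>\<omega>. \<bar>W i \<omega>\<bar>)) \<le> (1 + K) * card I" .
  have tail: "prob {\<omega> \<in> space M. x < (\<Sum>i\<in>I. max (V i \<omega>) 0 - expectation (\<lambda>\<omega>. max (V i \<omega>) 0))} \<le> C"
    if V: "upper_orthant_dependent I V" "\<And>i \<omega>. \<bar>V i \<omega>\<bar> = \<bar>W i \<omega>\<bar>" for V
  proof -
    have [measurable]: "V i \<in> borel_measurable M" if "i \<in> I" for i
      using V that by (simp add: upper_orthant_dependent_def)
    have le: "\<bar>max (V i \<omega>) 0\<bar> powr q \<le> \<bar>W i \<omega>\<bar> powr q" for i \<omega>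
      using q V(2)[of i \<omega>] by (intro powr_mono2) auto
    have int: "integrable M (\<lambda>\<omega>. \<bar>max (V i \<omega>) 0\<bar> powr q)" if i: "i \<in> I" for i
    proof (rule Bochner_Integration.integrable_bound[OF intW[OF i]])
      show "(\<lambda>\<omega>. \<bar>max (V i \<omega>) 0\<bar> powr q) \<in> borel_measurable M" using i by measurable
    qed (use le in auto)
    have "(\<Sum>i\<in>I. expectation (\<lambda>\<omega>. \<bar>max (V i \<omega>) 0\<bar> powr q)) \<le> (\<Sum>i\<in>I. expectation (\<lambda>\<omega>. \<bar>W i \<omega>\<bar> powr q))"
      by (intro sum_mono integral_mono int intW le)
    then have sum: "(\<Sum>i\<in>I. expectation (\<lambda>\<omega>. \<bar>max (V i \<omega>) 0\<bar> powr q)) \<le> K * card I"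
      using sumW by linarith
    have "upper_orthant_dependent I (\<lambda>i \<omega>. max (V i \<omega>) 0)"
      by (rule upper_orthant_dependent_mono[OF V(1), where f = "\<lambda>_ z. max z 0"])
        (auto intro!: continuous_intros monoI max.mono)
    from upper_orthant_dependent_moment_tail[OF this I q int sum K x] show ?thesis unfolding C_def by simp
  qed
  define Tp where "Tp \<omega> = (\<Sum>i\<in>I. max (W i \<omega>) 0 - expectation (\<lambda>\<omega>. max (W i \<omega>) 0))" for \<omega>
  define Tn where "Tn \<omega> = (\<Sum>i\<in>I. max (- W i \<omega>) 0 - expectation (\<lambda>\<omega>. max (- W i \<omega>) 0))" for \<omega>
  have [measurable]: "Tp \<in> borel_measurable M" "Tn \<in> borel_measurable M"
    unfolding Tp_def Tn_def using fin by measurable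
  have split: "(\<Sum>i\<in>I. \<bar>W i \<omega>\<bar>) = Tp \<omega> + Tn \<omega> + (\<Sum>i\<in>I. expectation (\<lambda>\<omega>. \<bar>W i \<omega>\<bar>))" for \<omega>
    unfolding Tp_def Tn_def sum.distrib[symmetric]
  proof (rule sum.cong[OF refl])
    fix i assume i: "i \<in> I"
    have ip: "integrable M (\<lambda>\<omega>. max (W i \<omega>) 0)" "integrable M (\<lambda>\<omega>. max (- W i \<omega>) 0)"
      by (rule Bochner_Integration.integrable_bound[OF int1[OF i]]; use i in \<open>auto\<close>)+
    have "\<bar>w\<bar> = max w 0 + max (- w) 0" for w :: real by auto
    then show "\<bar>W i \<omega>\<bar> = max (W i \<omega>) 0 - expectation (\<lambda>\<omega>. max (W i \<omega>) 0) +
        (max (- W i \<omega>) 0 - expectation (\<lambda>\<omega>. max (- W i \<omega>) 0)) + expectation (\<lambda>\<omega>. \<bar>W i \<omega>\<bar>)"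
      using ip by simp
  qed
  have "prob {\<omega> \<in> space M. 2 * x + (1 + K) * card I < (\<Sum>i\<in>I. \<bar>W i \<omega>\<bar>)} \<le>
      prob ({\<omega> \<in> space M. x < Tp \<omega>} \<union> {\<omega> \<in> space M. x < Tn \<omega>})"
    unfolding split using sum1 by (intro finite_measure_mono) auto
  also have "\<dots> \<le> prob {\<omega> \<in> space M. x < Tp \<omega>} + prob {\<omega> \<in> space M. x < Tn \<omega>}"
    by (intro measure_Un_le) auto
  also have "\<dots> \<le> C + C"
    unfolding Tp_def Tn_def
    using tail[OF upper_orthant_dependent_of_NOD[OF NOD]] tail[OF upper_orthant_dependent_uminus_of_NOD[OF NOD]]
    by (intro add_mono) auto
  finally show "prob {\<omega> \<in> space M. 2 * x + (1 + K) * card I < (\<Sum>i\<in>I. \<bar>W i \<omega>\<bar>)} \<le>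
      2 * (moment_tail_const q K * card I powr (q / 2) / x powr q)"
    by (simp add: C_def)
qed

section \<open>The uniform law\<close>

lemma covering_number_attained:
  assumes "compact S" "0 < r"
  shows "\<exists>C. C \<subseteq> S \<and> finite C \<and> card C = covering_number S r \<and> S \<subseteq> (\<Union>x\<in>C. ball x r)"
proof -
  have "\<exists>C. C \<subseteq> S \<and> finite C \<and> S \<subseteq> (\<Union>x\<in>C. ball x r)"
    by (rule compactE_image[OF \<open>compact S\<close>, of S "\<lambda>x. ball x r"]) (use \<open>0 < r\<close> in auto)
  then have "\<exists>k C. C \<subseteq> S \<and> finite C \<and> card C = k \<and> S \<subseteq> (\<Union>x\<in>C. ball x r)"
    by blast
  then show ?thesis unfolding covering_number_def by (rule LeastI_ex)
qed

lemma (in prob_space) centered_weighted_sum_Lipschitz: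
  fixes W f g :: "'i \<Rightarrow> 'a \<Rightarrow> real"
  assumes W: "\<And>i. i \<in> I \<Longrightarrow> integrable M (\<lambda>\<omega>. \<bar>W i \<omega>\<bar>)"
    and f: "\<And>i. i \<in> I \<Longrightarrow> integrable M (\<lambda>\<omega>. W i \<omega> * f i \<omega>)"
    and g: "\<And>i. i \<in> I \<Longrightarrow> integrable M (\<lambda>\<omega>. W i \<omega> * g i \<omega>)"
    and close: "\<And>i \<omega>. \<bar>f i \<omega> - g i \<omega>\<bar> \<le> \<eta>"
  shows "\<bar>(\<Sum>i\<in>I. W i \<omega> * f i \<omega> - expectation (\<lambda>\<omega>. W i \<omega> * f i \<omega>)) -
      (\<Sum>i\<in>I. W i \<omega> * g i \<omega> - expectation (\<lambda>\<omega>. W i \<omega> * g i \<omega>))\<bar>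
    \<le> \<eta> * ((\<Sum>i\<in>I. \<bar>W i \<omega>\<bar>) + (\<Sum>i\<in>I. expectation (\<lambda>\<omega>. \<bar>W i \<omega>\<bar>)))"
proof -
  have le: "\<bar>W i \<omega> * f i \<omega> - W i \<omega> * g i \<omega>\<bar> \<le> \<eta> * \<bar>W i \<omega>\<bar>" for i \<omega>
  proof -
    have "\<bar>W i \<omega> * f i \<omega> - W i \<omega> * g i \<omega>\<bar> = \<bar>f i \<omega> - g i \<omega>\<bar> * \<bar>W i \<omega>\<bar>"
      by (simp add: abs_mult[symmetric] algebra_simps)
    then show ?thesis using close by (simp add: mult_right_mono)
  qed
  have summand: "\<bar>(W i \<omega> * f i \<omega> - expectation (\<lambda>\<omega>. W i \<omega> * f i \<omega>)) - (W i \<omega> * g i \<omega> - expectation (\<lambda>\<omega>. W i \<omega> * g i \<omega>))\<bar>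
      \<le> \<eta> * \<bar>W i \<omega>\<bar> + \<eta> * expectation (\<lambda>\<omega>. \<bar>W i \<omega>\<bar>)" if i: "i \<in> I" for i
  proof -
    have "\<bar>expectation (\<lambda>\<omega>. W i \<omega> * f i \<omega>) - expectation (\<lambda>\<omega>. W i \<omega> * g i \<omega>)\<bar> =
        \<bar>expectation (\<lambda>\<omega>. W i \<omega> * f i \<omega> - W i \<omega> * g i \<omega>)\<bar>"
      using f[OF i] g[OF i] by simp
    also have "\<dots> \<le> expectation (\<lambda>\<omega>. \<bar>W i \<omega> * f i \<omega> - W i \<omega> * g i \<omega>\<bar>)"
      by (rule integral_abs_bound)
    also have "\<dots> \<le> expectation (\<lambda>\<omega>. \<eta> * \<bar>W i \<omega>\<bar>)"
      using f[OF i] g[OF i] W[OF i] by (intro integral_mono le) auto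
    also have "\<dots> = \<eta> * expectation (\<lambda>\<omega>. \<bar>W i \<omega>\<bar>)" by simp
    finally show ?thesis using le[of i \<omega>] by linarith
  qed
  show ?thesis
    unfolding sum_subtractf[symmetric]
    by (rule order.trans[OF sum_abs]) (use sum_mono[OF summand, of I "\<lambda>i. i"] in \<open>simp add: sum.distrib sum_distrib_left distrib_left\<close>)
qed

lemma nn_integral_eq_of_distr_eq:
  assumes "distr M N X = distr M N Y" "X \<in> measurable M N" "Y \<in> measurable M N" "f \<in> borel_measurable N"
  shows "(\<integral>\<^sup>+\<omega>. f (X \<omega>) \<partial>M) = (\<integral>\<^sup>+\<omega>. f (Y \<omega>) \<partial>M)"
  using nn_integral_distr[OF assms(2), of f] nn_integral_distr[OF assms(3), of f] assms by simp

theorem theorem3: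
  fixes \<Theta> :: "'a::{metric_space, second_countable_topology} set"
    and H :: "'a \<Rightarrow> real ^ 'u \<Rightarrow> real"
    and P :: "'b measure"
    and X :: "nat \<Rightarrow> 'b \<Rightarrow> real ^ 'u"
    and W :: "nat \<Rightarrow> nat \<Rightarrow> 'b \<Rightarrow> real"
    and a M \<delta> c D p q :: real
  assumes "compact \<Theta>"
    and "\<And>x. continuous_on \<Theta> (\<lambda>\<theta>. H \<theta> x)"
    and "\<And>\<theta>. \<theta> \<in> \<Theta> \<Longrightarrow> H \<theta> \<in> borel_measurable borel"
    and "a > 0" and "M > 0" and "\<delta> > 0"
    and "\<And>x \<theta> \<theta>'. \<theta> \<in> \<Theta> \<Longrightarrow> \<theta>' \<in> \<Theta> \<Longrightarrow> dist \<theta> \<theta>' < \<delta> \<Longrightarrow>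
           \<bar>H \<theta> x - H \<theta>' x\<bar> \<le> M * dist \<theta> \<theta>' powr a"
    and "c > 0" and "D > 0"
    and "\<forall>\<^sub>F r in at_right 0. real (covering_number \<Theta> r) \<le> c * r powr (- D)"
    and "prob_space P"
    and "prob_space.indep_vars P (\<lambda>_. borel) X {1..}"
    and "\<And>i. i \<ge> 1 \<Longrightarrow> distr P borel (X i) = distr P borel (X 1)"
    and "\<And>n. n \<ge> 1 \<Longrightarrow> neg_orthant_dependent P {1..n} (W n)"
    and "prob_space.indep_vars P (\<lambda>n. PiM {1..n} (\<lambda>_. borel))
           (\<lambda>n \<omega>. \<lambda>j\<in>{1..n}. W n j \<omega>) {1..}"
    and "indep_pair P
           (PiM {1..} (\<lambda>n. PiM {1..n} (\<lambda>_. borel))) (\<lambda>\<omega>. \<lambda>n\<in>{1..}. \<lambda>j\<in>{1..n}. W n j \<omega>)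
           (PiM {1..} (\<lambda>_. borel)) (\<lambda>\<omega>. \<lambda>j\<in>{1..}. X j \<omega>)"
    and "1 < p" and "p < 2"
    and "q > ((1 - 1 / p) * D / a + 1) / (1 / p - 1 / 2)"
    and "(SUP \<theta>\<in>\<Theta>. \<integral>\<^sup>+\<omega>. ennreal (\<bar>H \<theta> (X 1 \<omega>)\<bar> powr q) \<partial>P) < \<infinity>"
    and "\<forall>\<^sub>F n in sequentially. \<forall>j\<in>{1..n}. integrable P (\<lambda>\<omega>. \<bar>W n j \<omega>\<bar> powr q)"
    and "(\<lambda>n. \<Sum>j=1..n. \<integral>\<omega>. \<bar>W n j \<omega>\<bar> powr q \<partial>P) \<in> O(\<lambda>n. real n)"
  shows "AE \<omega> in P.
    (\<lambda>n. SUP \<theta>\<in>\<Theta>. ennreal \<bar>1 / real n powr (1 / p) *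
       (\<Sum>j=1..n. W n j \<omega> * H \<theta> (X j \<omega>) - (\<integral>\<omega>'. W n j \<omega>' * H \<theta> (X j \<omega>') \<partial>P))\<bar>)
      \<longlonglongrightarrow> 0"
proof -
  note Hmeas = assms(3) and a = assms(4) and Mpos = assms(5) and \<delta> = assms(6)
    and Holder = assms(7) and c = assms(8) and D = assms(9) and cov = assms(10)
    and X = assms(12) and X_id = assms(13) and NOD = assms(14) and WX = assms(16)
    and p = assms(17,18) and q = assms(19) and supH = assms(20) and intW = assms(21) and sumW = assms(22)
  interpret prob_space P by fact
  define s where "s = 1 / p - 1 / 2"
  define b where "b = 1 - 1 / p"
  have s: "0 < s" "s < 1 / 2" and b: "0 < b" using p by (simp_all add: s_def b_def field_simps)
  have qs: "b * D / a + 1 < q * s"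
    using q s(1) unfolding s_def[symmetric] b_def[symmetric] by (simp add: pos_divide_less_eq)
  have "1 < q * s" using qs b D a by (smt (verit) divide_pos_pos mult_pos_pos)
  have q2: "2 < q"
  proof (rule ccontr)
    assume "\<not> 2 < q"
    then have "q * s \<le> 2 * s" using s by (intro mult_right_mono) auto
    then show False using \<open>1 < q * s\<close> s by linarith
  qed
  \<comment> \<open>Half of the slack in the hypothesis on \<open>q\<close>. Finer balls cost \<open>\<epsilon> * D\<close> in the exponent of the covering number and the smaller deviation level costs \<open>\<epsilon> * q\<close> in the tail bound, so the two together use up that half.\<close>
  define \<epsilon> where "\<epsilon> = (q * s - b * D / a - 1) / (2 * (D + q))"
  have \<epsilon>: "0 < \<epsilon>" using qs D q2 by (simp add: \<epsilon>_def)
  have \<epsilon>_eq: "\<epsilon> * (D + q) = (q * s - b * D / a - 1) / 2"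
  proof -
    have "x / (2 * z) * z = x / 2" if "z \<noteq> 0" for x z :: real using that by simp
    from this[of "D + q"] show ?thesis unfolding \<epsilon>_def using D q2 by simp
  qed
  define \<gamma> where "\<gamma> = b / a + \<epsilon>"
  define \<beta> where "\<beta> = 1 / p - \<epsilon>"
  have \<gamma>: "0 < \<gamma>" using b a \<epsilon> by (simp add: \<gamma>_def add_pos_pos)
  have expo: "\<gamma> * D + q / 2 - q * \<beta> < - 1"
  proof -
    have "\<gamma> * D + q / 2 - q * \<beta> = b * D / a - q * s + \<epsilon> * (D + q)"
      by (simp add: \<gamma>_def \<beta>_def s_def algebra_simps)
    moreover have "w - v + (v - w - 1) / 2 < - 1" if "w + 1 < v" for v w :: real
      using that by (simp add: field_simps)
    ultimately show ?thesis using qs unfolding \<epsilon>_eq by simp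
  qed

  obtain K where K: "0 < K" and sumW': "\<forall>\<^sub>F n in sequentially. (\<Sum>j=1..n. \<integral>\<omega>. \<bar>W n j \<omega>\<bar> powr q \<partial>P) \<le> K * real n"
  proof (rule landau_o.bigE[OF sumW])
    fix K :: real assume "0 < K"
      and ev: "\<forall>\<^sub>F n in sequentially. norm (\<Sum>j=1..n. \<integral>\<omega>. \<bar>W n j \<omega>\<bar> powr q \<partial>P) \<le> K * norm (real n)"
    have "\<forall>\<^sub>F n in sequentially. (\<Sum>j=1..n. \<integral>\<omega>. \<bar>W n j \<omega>\<bar> powr q \<partial>P) \<le> K * real n"
      using ev by eventually_elim simp
    then show thesis using that \<open>0 < K\<close> by blast
  qed
  define L where "L = enn2real (SUP \<theta>\<in>\<Theta>. \<integral>\<^sup>+\<omega>. ennreal (\<bar>H \<theta> (X 1 \<omega>)\<bar> powr q) \<partial>P)"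
  have L: "0 \<le> L" by (simp add: L_def)
  have X_meas: "X j \<in> borel_measurable P" if "1 \<le> j" for j
    using X that by (simp add: indep_vars_def)
  have H_moment: "integrable P (\<lambda>\<omega>. \<bar>H \<theta> (X j \<omega>)\<bar> powr q)" "expectation (\<lambda>\<omega>. \<bar>H \<theta> (X j \<omega>)\<bar> powr q) \<le> L"
    if "\<theta> \<in> \<Theta>" "1 \<le> j" for \<theta> j
  proof -
    note [measurable] = Hmeas[OF that(1)] X_meas[OF that(2)]
    have "(\<integral>\<^sup>+\<omega>. ennreal (\<bar>H \<theta> (X j \<omega>)\<bar> powr q) \<partial>P) = (\<integral>\<^sup>+\<omega>. ennreal (\<bar>H \<theta> (X 1 \<omega>)\<bar> powr q) \<partial>P)"
      using nn_integral_eq_of_distr_eq[OF X_id[OF that(2)] X_meas[OF that(2)] X_meas, of "\<lambda>x. ennreal (\<bar>H \<theta> x\<bar> powr q)"]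
      by simp
    also have "\<dots> \<le> (SUP \<theta>\<in>\<Theta>. \<integral>\<^sup>+\<omega>. ennreal (\<bar>H \<theta> (X 1 \<omega>)\<bar> powr q) \<partial>P)"
      by (intro SUP_upper that)
    also have "\<dots> = ennreal L" using supH by (simp add: L_def less_top)
    finally have le: "(\<integral>\<^sup>+\<omega>. ennreal (\<bar>H \<theta> (X j \<omega>)\<bar> powr q) \<partial>P) \<le> ennreal L" .
    show int: "integrable P (\<lambda>\<omega>. \<bar>H \<theta> (X j \<omega>)\<bar> powr q)"
      by (rule integrableI_nonneg) (use le in \<open>auto intro: le_less_trans\<close>)
    show "expectation (\<lambda>\<omega>. \<bar>H \<theta> (X j \<omega>)\<bar> powr q) \<le> L"
      using le nn_integral_eq_integral[OF int] L by simp
  qed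
  have WX_row: "indep_pair P (PiM {1..n} (\<lambda>_. borel)) (\<lambda>\<omega>. \<lambda>j\<in>{1..n}. W n j \<omega>)
      (PiM {1..n} (\<lambda>_. borel)) (\<lambda>\<omega>. \<lambda>j\<in>{1..n}. X j \<omega>)" if n: "1 \<le> n" for n
  proof -
    have "(\<lambda>w. w n) \<in> measurable (PiM {1..} (\<lambda>n. PiM {1..n} (\<lambda>_. borel :: real measure))) (PiM {1..n} (\<lambda>_. borel))"
      using n by (intro measurable_component_singleton) simp
    moreover have "(\<lambda>x. restrict x {1..n}) \<in> measurable (PiM {1..} (\<lambda>_. borel :: (real ^ 'u) measure)) (PiM {1..n} (\<lambda>_. borel))"
      by (intro measurable_restrict_subset) auto
    moreover have "{1..} \<inter> {1..n} = {1..n}" by auto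
    ultimately show ?thesis
      using indep_pair_compose[OF WX, of "\<lambda>w. w n" _ "\<lambda>x. restrict x {1..n}"] n by simp
  qed

  define r where "r n = real n powr - \<gamma>" for n
  have "filterlim r (at_right 0) sequentially"
  proof (rule tendsto_imp_filterlim_at_right)
    show "r \<longlonglongrightarrow> 0"
      unfolding r_def using \<gamma> by (intro tendsto_neg_powr filterlim_real_sequentially) simp
    show "\<forall>\<^sub>F n in sequentially. 0 < r n"
      using eventually_gt_at_top[of 0] by eventually_elim (simp add: r_def)
  qed
  note r_lim = this
  have cov': "\<forall>\<^sub>F n in sequentially. real (covering_number \<Theta> (r n)) \<le> c * r n powr (- D)"
    by (rule eventually_compose_filterlim[OF cov r_lim])
  have "\<forall>\<^sub>F t in at_right 0. t < \<delta>"
    using eventually_at_right_real[OF \<delta>] by eventually_elim simp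
  then have small: "\<forall>\<^sub>F n in sequentially. r n < \<delta>"
    by (rule eventually_compose_filterlim[OF _ r_lim])
  have "\<forall>\<^sub>F n in sequentially. 1 \<le> n \<and> (\<forall>j\<in>{1..n}. integrable P (\<lambda>\<omega>. \<bar>W n j \<omega>\<bar> powr q)) \<and>
      (\<Sum>j=1..n. \<integral>\<omega>. \<bar>W n j \<omega>\<bar> powr q \<partial>P) \<le> K * real n \<and>
      real (covering_number \<Theta> (r n)) \<le> c * r n powr (- D) \<and> r n < \<delta>"
    using eventually_ge_at_top[of 1] intW sumW' cov' small by eventually_elim blast
  then obtain N where N: "\<And>n. N \<le> n \<Longrightarrow> 1 \<le> n"
      "\<And>n j. N \<le> n \<Longrightarrow> j \<in> {1..n} \<Longrightarrow> integrable P (\<lambda>\<omega>. \<bar>W n j \<omega>\<bar> powr q)"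
      "\<And>n. N \<le> n \<Longrightarrow> (\<Sum>j=1..n. \<integral>\<omega>. \<bar>W n j \<omega>\<bar> powr q \<partial>P) \<le> K * real n"
      "\<And>n. N \<le> n \<Longrightarrow> real (covering_number \<Theta> (r n)) \<le> c * r n powr (- D)"
      "\<And>n. N \<le> n \<Longrightarrow> r n < \<delta>"
    unfolding eventually_sequentially by blast

  have "\<exists>C. N \<le> n \<longrightarrow> C \<subseteq> \<Theta> \<and> finite C \<and> real (card C) \<le> c * r n powr (- D) \<and> \<Theta> \<subseteq> (\<Union>\<theta>\<in>C. ball \<theta> (r n))" for n
  proof (cases "N \<le> n")
    case True
    have "0 < r n" using N(1)[OF True] by (simp add: r_def)
    from covering_number_attained[OF assms(1) this] N(4)[OF True] show ?thesis by metis
  qed simp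
  then have "\<exists>C. \<forall>n. N \<le> n \<longrightarrow> C n \<subseteq> \<Theta> \<and> finite (C n) \<and> real (card (C n)) \<le> c * r n powr (- D) \<and>
      \<Theta> \<subseteq> (\<Union>\<theta>\<in>C n. ball \<theta> (r n))"
    by (intro choice allI)
  then obtain C where C: "\<And>n. N \<le> n \<Longrightarrow> C n \<subseteq> \<Theta>" "\<And>n. N \<le> n \<Longrightarrow> finite (C n)"
      "\<And>n. N \<le> n \<Longrightarrow> real (card (C n)) \<le> c * r n powr (- D)"
      "\<And>n. N \<le> n \<Longrightarrow> \<Theta> \<subseteq> (\<Union>\<theta>\<in>C n. ball \<theta> (r n))"
    by blast

  define T where "T n \<theta> \<omega> = (\<Sum>j=1..n. W n j \<omega> * H \<theta> (X j \<omega>) - (\<integral>\<omega>'. W n j \<omega>' * H \<theta> (X j \<omega>') \<partial>P))" for n \<theta> \<omega>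
  define A where "A n \<theta> = {\<omega> \<in> space P. 2 * real n powr \<beta> < \<bar>T n \<theta> \<omega>\<bar>}" for n \<theta>
  define B where "B n = {\<omega> \<in> space P. (3 + K) * real n < (\<Sum>j=1..n. \<bar>W n j \<omega>\<bar>)}" for n
  define C1 where "C1 = 4 * moment_tail_const q (K * L)"
  define C2 where "C2 = 2 * moment_tail_const q K"
  have C1: "0 \<le> C1" using q2 K L by (simp add: C1_def moment_tail_const_def)
  have W_meas: "W n j \<in> borel_measurable P" if "1 \<le> n" "j \<in> {1..n}" for n j
    using NOD[OF that(1)] that(2) by (simp add: neg_orthant_dependent_def)
  have row: "\<And>j. j \<in> {1..n} \<Longrightarrow> integrable P (\<lambda>\<omega>. W n j \<omega> * H \<theta> (X j \<omega>))"
    "prob (A n \<theta>) \<le> C1 * real n powr (q / 2 - q * \<beta>)" "A n \<theta> \<in> events"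
    if n: "N \<le> n" and \<theta>: "\<theta> \<in> \<Theta>" for n \<theta>
  proof -
    note n1 = N(1)[OF n]
    have X_row: "indep_vars (\<lambda>_. borel) X {1..n}"
      by (rule indep_vars_subset[OF X]) auto
    have ne: "{1..n} \<noteq> {}" using n1 by simp
    have sum: "(\<Sum>j\<in>{1..n}. expectation (\<lambda>\<omega>. \<bar>W n j \<omega>\<bar> powr q)) \<le> K * real (card {1..n})"
      using N(3)[OF n] by simp
    have x: "0 < real n powr \<beta>" using n1 by simp
    have Hint: "integrable P (\<lambda>\<omega>. \<bar>H \<theta> (X j \<omega>)\<bar> powr q)" "expectation (\<lambda>\<omega>. \<bar>H \<theta> (X j \<omega>)\<bar> powr q) \<le> L"
      if "j \<in> {1..n}" for j using H_moment[OF \<theta>, of j] that by auto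
    note tail = NOD_weighted_sum_moment_tail[OF NOD[OF n1] ne q2 N(2)[OF n] sum X_row WX_row[OF n1] Hmeas[OF \<theta>]
        Hint less_imp_le[OF K] L x]
    show "integrable P (\<lambda>\<omega>. W n j \<omega> * H \<theta> (X j \<omega>))" if "j \<in> {1..n}" for j
      by (rule tail(1)[OF _ _ _ that])
    have "prob (A n \<theta>) \<le> C1 * (real n powr (q / 2) / (real n powr \<beta>) powr q)"
      using tail(2) by (simp add: A_def T_def C1_def)
    also have "real n powr (q / 2) / (real n powr \<beta>) powr q = real n powr (q / 2 - q * \<beta>)"
      by (simp add: powr_powr powr_diff mult.commute)
    finally show "prob (A n \<theta>) \<le> C1 * real n powr (q / 2 - q * \<beta>)" .
    have "T n \<theta> \<in> borel_measurable P"
      unfolding T_def using W_meas[OF n1] measurable_compose[OF X_meas Hmeas[OF \<theta>]]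
      by (intro borel_measurable_sum borel_measurable_diff borel_measurable_times) auto
    then show "A n \<theta> \<in> events" unfolding A_def by measurable
  qed
  have absW: "\<And>j. j \<in> {1..n} \<Longrightarrow> integrable P (\<lambda>\<omega>. \<bar>W n j \<omega>\<bar>)"
    "(\<Sum>j=1..n. expectation (\<lambda>\<omega>. \<bar>W n j \<omega>\<bar>)) \<le> (1 + K) * real n"
    "prob (B n) \<le> C2 * real n powr (- (q / 2))" "B n \<in> events" if n: "N \<le> n" for n
  proof -
    note n1 = N(1)[OF n]
    have ne: "{1..n} \<noteq> {}" using n1 by simp
    have sum: "(\<Sum>j\<in>{1..n}. expectation (\<lambda>\<omega>. \<bar>W n j \<omega>\<bar> powr q)) \<le> K * real (card {1..n})"
      using N(3)[OF n] by simp
    have x: "0 < real n" using n1 by simp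
    note tail = NOD_abs_sum_moment_tail[OF NOD[OF n1] ne q2 N(2)[OF n] sum less_imp_le[OF K] x]
    show "integrable P (\<lambda>\<omega>. \<bar>W n j \<omega>\<bar>)" if "j \<in> {1..n}" for j
      by (rule tail(1)[OF _ that])
    show "(\<Sum>j=1..n. expectation (\<lambda>\<omega>. \<bar>W n j \<omega>\<bar>)) \<le> (1 + K) * real n"
      using tail(2) by simp
    have "prob (B n) \<le> C2 * (real n powr (q / 2) / real n powr q)"
      using tail(3) by (simp add: B_def C2_def algebra_simps)
    also have "real n powr (q / 2) / real n powr q = real n powr (- (q / 2))"
      by (simp add: powr_diff[symmetric])
    finally show "prob (B n) \<le> C2 * real n powr (- (q / 2))" .
    show "B n \<in> events"
      unfolding B_def using W_meas[OF n1] by measurable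
  qed

  \<comment> \<open>Outside \<open>bad n\<close> the sums are small on the net and the weights have bounded average.\<close>
  define bad where "bad n = (if N \<le> n then (\<Union>\<theta>\<in>C n. A n \<theta>) \<union> B n else {})" for n
  have bad_events: "bad n \<in> events" for n
  proof (cases "N \<le> n")
    case True
    then have "(\<Union>\<theta>\<in>C n. A n \<theta>) \<union> B n \<in> events"
      using C(1,2)[of n] row(3)[of n] absW(4)[of n] by (intro sets.Un sets.finite_UN) auto
    then show ?thesis using True by (simp add: bad_def)
  qed (simp add: bad_def)
  have bad_le: "prob (bad n) \<le> c * C1 * real n powr (\<gamma> * D + q / 2 - q * \<beta>) + C2 * real n powr (- (q / 2))"
    if n: "N \<le> n" for n
  proof -
    have "(\<Union>\<theta>\<in>C n. A n \<theta>) \<in> events"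
      using C(1,2)[OF n] row(3)[OF n] by (intro sets.finite_UN) auto
    then have "prob (bad n) \<le> prob (\<Union>\<theta>\<in>C n. A n \<theta>) + prob (B n)"
      using n absW(4)[OF n] by (simp add: bad_def measure_Un_le)
    also have "prob (\<Union>\<theta>\<in>C n. A n \<theta>) \<le> (\<Sum>\<theta>\<in>C n. prob (A n \<theta>))"
      using C(1,2)[OF n] row(3)[OF n] by (intro finite_measure_subadditive_finite) auto
    also have "\<dots> \<le> real (card (C n)) * (C1 * real n powr (q / 2 - q * \<beta>))"
      using C(1)[OF n] row(2)[OF n] by (intro sum_bounded_above) auto
    also have "\<dots> \<le> (c * r n powr (- D)) * (C1 * real n powr (q / 2 - q * \<beta>))"
      using C1 C(3)[OF n] by (intro mult_right_mono) auto
    also have "\<dots> = c * C1 * real n powr (\<gamma> * D + q / 2 - q * \<beta>)"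
    proof -
      have "r n powr (- D) = real n powr (\<gamma> * D)" by (simp add: r_def powr_powr)
      moreover have "real n powr (\<gamma> * D + q / 2 - q * \<beta>) = real n powr (\<gamma> * D) * real n powr (q / 2 - q * \<beta>)"
        by (simp only: powr_add[symmetric] add_diff_eq)
      ultimately show ?thesis by simp
    qed
    finally show ?thesis using absW(3)[OF n] by simp
  qed
  have "summable (\<lambda>n. prob (bad n))"
  proof (rule summable_comparison_test')
    show "summable (\<lambda>n. c * C1 * real n powr (\<gamma> * D + q / 2 - q * \<beta>) + C2 * real n powr (- (q / 2)))"
      using expo q2 by (intro summable_add summable_mult) (auto simp: summable_real_powr_iff)
    show "norm (prob (bad n)) \<le> c * C1 * real n powr (\<gamma> * D + q / 2 - q * \<beta>) + C2 * real n powr (- (q / 2))" if "N \<le> n" for n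
      using bad_le[OF that] by simp
  qed
  then have good: "AE \<omega> in P. \<forall>\<^sub>F n in sequentially. \<omega> \<in> space P - bad n"
    using bad_events by (intro borel_cantelli_AE1) (auto simp: emeasure_eq_measure)

  define u where "u n = 2 * real n powr (- \<epsilon>) + M * (4 + 2 * K) * real n powr (- (\<epsilon> * a))" for n
  have u: "u \<longlonglongrightarrow> 0"
    unfolding u_def using \<epsilon> a
  proof -
    have "(\<lambda>n. real n powr (- e)) \<longlonglongrightarrow> 0" if "0 < e" for e
      using that by (intro tendsto_neg_powr filterlim_real_sequentially) simp
    from tendsto_add[OF tendsto_mult_right_zero[OF this] tendsto_mult_right_zero[OF this]]
    show "(\<lambda>n. 2 * real n powr (- \<epsilon>) + M * (4 + 2 * K) * real n powr (- (\<epsilon> * a))) \<longlonglongrightarrow> 0"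
      using \<epsilon> a by simp
  qed
  have uniform: "\<bar>1 / real n powr (1 / p) * T n \<theta> \<omega>\<bar> \<le> u n" if n: "N \<le> n" and \<omega>: "\<omega> \<in> space P - bad n" and \<theta>: "\<theta> \<in> \<Theta>" for n \<omega> \<theta>
  proof -
    note n1 = N(1)[OF n]
    have "\<theta> \<in> (\<Union>\<theta>\<in>C n. ball \<theta> (r n))" using C(4)[OF n] \<theta> by (rule subsetD)
    then obtain \<theta>' where \<theta>': "\<theta>' \<in> C n" "dist \<theta>' \<theta> < r n" unfolding UN_iff mem_ball by blast
    then have \<theta>'\<Theta>: "\<theta>' \<in> \<Theta>" using C(1)[OF n] by blast
    have "\<omega> \<in> space P" "\<omega> \<notin> A n \<theta>'" "\<omega> \<notin> B n"
      using \<omega> \<theta>'(1) n unfolding bad_def by auto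
    then have net: "\<bar>T n \<theta>' \<omega>\<bar> \<le> 2 * real n powr \<beta>" and sumW_le: "(\<Sum>j=1..n. \<bar>W n j \<omega>\<bar>) \<le> (3 + K) * real n"
      unfolding A_def B_def by simp_all
    have close: "\<bar>H \<theta> x - H \<theta>' x\<bar> \<le> M * r n powr a" for x
    proof -
      have "\<bar>H \<theta> x - H \<theta>' x\<bar> \<le> M * dist \<theta> \<theta>' powr a"
        using \<theta>' N(5)[OF n] by (intro Holder \<theta> \<theta>'\<Theta>) (simp add: dist_commute)
      also have "\<dots> \<le> M * r n powr a"
        using \<theta>' a Mpos by (intro mult_left_mono powr_mono2) (auto simp: dist_commute)
      finally show ?thesis .
    qed
    have "\<bar>T n \<theta> \<omega> - T n \<theta>' \<omega>\<bar> \<le> (M * r n powr a) * ((\<Sum>j=1..n. \<bar>W n j \<omega>\<bar>) + (\<Sum>j=1..n. expectation (\<lambda>\<omega>. \<bar>W n j \<omega>\<bar>)))"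
      unfolding T_def by (rule centered_weighted_sum_Lipschitz) (use absW(1) row(1) n \<theta> \<theta>'\<Theta> close in auto)
    also have "\<dots> \<le> (M * r n powr a) * ((3 + K) * real n + (1 + K) * real n)"
      using Mpos sumW_le absW(2)[OF n] by (intro mult_left_mono add_mono) auto
    finally have diff: "\<bar>T n \<theta> \<omega> - T n \<theta>' \<omega>\<bar> \<le> M * (4 + 2 * K) * (r n powr a * real n)"
      by (simp add: algebra_simps)
    have "\<bar>T n \<theta> \<omega>\<bar> \<le> 2 * real n powr \<beta> + M * (4 + 2 * K) * (r n powr a * real n)"
      using diff net by linarith
    then have "\<bar>T n \<theta> \<omega>\<bar> / real n powr (1 / p) \<le> (2 * real n powr \<beta> + M * (4 + 2 * K) * (r n powr a * real n)) / real n powr (1 / p)"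
      by (rule divide_right_mono) simp
    also have "\<dots> = 2 * (real n powr \<beta> / real n powr (1 / p)) + M * (4 + 2 * K) * (r n powr a * real n / real n powr (1 / p))"
      by (simp add: add_divide_distrib)
    also have "real n powr \<beta> / real n powr (1 / p) = real n powr (- \<epsilon>)"
      by (simp add: powr_diff[symmetric] \<beta>_def)
    also have "r n powr a * real n / real n powr (1 / p) = real n powr (- (\<epsilon> * a))"
    proof -
      have "r n powr a * real n / real n powr (1 / p) = real n powr (- \<gamma> * a) * real n powr 1 / real n powr (1 / p)"
        using n1 by (simp add: r_def powr_powr)
      also have "\<dots> = real n powr (- \<gamma> * a + 1 - 1 / p)"
        by (simp only: powr_add[symmetric] powr_diff[symmetric])
      also have "- \<gamma> * a + 1 - 1 / p = - (\<epsilon> * a)"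
      proof -
        have "\<gamma> * a = b + \<epsilon> * a" using a by (simp add: \<gamma>_def distrib_right)
        then show ?thesis by (simp add: b_def)
      qed
      finally show ?thesis .
    qed
    finally show ?thesis by (simp add: u_def abs_mult)
  qed
  show ?thesis
    using good
  proof eventually_elim
    fix \<omega> assume "\<forall>\<^sub>F n in sequentially. \<omega> \<in> space P - bad n"
    with eventually_ge_at_top[of N]
    have upper: "\<forall>\<^sub>F n in sequentially. (SUP \<theta>\<in>\<Theta>. ennreal \<bar>1 / real n powr (1 / p) * T n \<theta> \<omega>\<bar>) \<le> ennreal (u n)"
      by eventually_elim (intro SUP_least ennreal_leI uniform)
    have lim: "(\<lambda>n. ennreal (u n)) \<longlonglongrightarrow> 0"
      using tendsto_ennrealI[OF u] by simp
    have "(\<lambda>n. SUP \<theta>\<in>\<Theta>. ennreal \<bar>1 / real n powr (1 / p) * T n \<theta> \<omega>\<bar>) \<longlonglongrightarrow> 0"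
      by (rule tendsto_sandwich[OF _ upper tendsto_const lim]) simp
    then show "(\<lambda>n. SUP \<theta>\<in>\<Theta>. ennreal \<bar>1 / real n powr (1 / p) *
       (\<Sum>j=1..n. W n j \<omega> * H \<theta> (X j \<omega>) - (\<integral>\<omega>'. W n j \<omega>' * H \<theta> (X j \<omega>') \<partial>P))\<bar>) \<longlonglongrightarrow> 0"
      unfolding T_def .
  qed
qed

end
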